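(* Let $(\mu,\nu)\in\mathcal P(\mathcal X)\times\mathcal P(\mathcal Y)$, where $\mathcal X\subset\mathbb R^{d_x}$ and $\mathcal Y\subset\mathbb R^{d_y}$ are compact. Let $U^\mu:\mathcal X\to L^2(\mathcal W_{\mathcal X},\lambda_{\mathcal X})$ and $V^\nu:\mathcal Y\to L^2(\mathcal W_{\mathcal Y},\lambda_{\mathcal Y})$ be the compact centered half-space embeddings (defined in the context), and set $(\mathcal W,\lambda):=(\mathcal W_{\mathcal X}\times\mathcal W_{\mathcal Y},\lambda_{\mathcal X}\otimes\lambda_{\mathcal Y})$. For $u\in\mathcal X$, $v\in\mathcal Y$ define $h_{u,v}\in L^2(\mathcal W,\lambda)$ by $h_{u,v}(\xi,\zeta)=\mathbf 1_{H_\xi}(u)\mathbf 1_{G_\zeta}(v)$. Then $$D_2^2(\mu,\nu)=E_{\mu,\nu}+\inf_{a\in\mathcal A}\left\{\frac18\|a\|^2_{L^2(\mathcal W,\lambda)}+T_{c_{a,\mu,\nu}}(\mu,\nu)\right\},$$ where $$E_{\mu,\nu}:=\iint\|x-x'\|^2\,d\mu(x)d\mu(x')+\iint\|y-y'\|^2\,d\nu(y)d\nu(y')-\left(\iint\|x-x'\|\,d\mu(x)d\mu(x')\right)\left(\iint\|y-y'\|\,d\nu(y)d\nu(y')\right),$$ $$\mathcal A:=\left\{8\sqrt{\kappa_{\mathcal X}\kappa_{\mathcal Y}}\int h_{u,v}\,d\eta(u,v):\ \eta\text{ a finite signed Borel measure on }\mathcal X\times\mathcal Y,\ \|\eta\|_{\mathrm{TV}}\le2\right\}\subset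 L^2(\mathcal W,\lambda)$$ (the integral being a Bochner integral in $L^2(\mathcal W,\lambda)$), and for each $a\in\mathcal A$ the cost $c_{a,\mu,\nu}:\mathcal X\times\mathcal Y\to\mathbb R$ is $$c_{a,\mu,\nu}(x,y)=-4\|U^\mu_x\|^2_{L^2(\mathcal W_{\mathcal X},\lambda_{\mathcal X})}\|V^\nu_y\|^2_{L^2(\mathcal W_{\mathcal Y},\lambda_{\mathcal Y})}-2\int a(\xi,\zeta)\,U^\mu_x(\xi)\,V^\nu_y(\zeta)\,d\lambda(\xi,\zeta).$$
   Context: $\mathcal P(S)$ denotes Borel probability measures on $S$, $\Pi(\mu,\nu)$ the couplings of $\mu,\nu$. $D_2^2(\mu,\nu):=\inf_{\gamma\in\Pi(\mu,\nu)}\iint|\,\|x-x'\|-\|y-y'\|\,|^2\,d\gamma(x,y)d\gamma(x',y')$. For a bounded measurable cost $c$, $T_c(\mu,\nu):=\inf_{\pi\in\Pi(\mu,\nu)}\int c\,d\pi$. $\|\eta\|_{\mathrm{TV}}=|\eta|(\mathcal X\times\mathcal Y)$ is the total variation norm. Compact half-space embedding: fix $R_{\mathcal X},R_{\mathcal Y}>0$ with $\mathcal X\subset B^{d_x}_{R_{\mathcal X}}(0)$, $\mathcal Y\subset B^{d_y}_{R_{\mathcal Y}}(0)$ (closed balls). Let $\sigma_{d-1}$ be the uniform probability measure on $\mathbb S^{d-1}$ and $a_d:=\mathbb E_{\theta\sim\sigma_{d-1}}|\theta_1|$. Set $\mathcal W_{\mathcal X}=\mathbb S^{d_x-1}\times[-R_{\mathcal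 X},R_{\mathcal X}]$ with probability measure $d\lambda_{\mathcal X}(\theta,t)=\frac1{2R_{\mathcal X}}d\sigma_{d_x-1}(\theta)dt$, $\kappa_{\mathcal X}=2R_{\mathcal X}/a_{d_x}$, and for $\xi=(\theta,t)\in\mathcal W_{\mathcal X}$, $H_\xi=\{x\in\mathcal X:\theta\cdot x>t\}$. Define $U^\mu_x(\xi)=\sqrt{\kappa_{\mathcal X}}\,(\mathbf 1_{H_\xi}(x)-\mu(H_\xi))$. Analogously, $\mathcal W_{\mathcal Y}=\mathbb S^{d_y-1}\times[-R_{\mathcal Y},R_{\mathcal Y}]$, $d\lambda_{\mathcal Y}(\theta,t)=\frac1{2R_{\mathcal Y}}d\sigma_{d_y-1}(\theta)dt$, $\kappa_{\mathcal Y}=2R_{\mathcal Y}/a_{d_y}$, $G_\zeta=\{y\in\mathcal Y:\theta\cdot y>t\}$ for $\zeta=(\theta,t)\in\mathcal W_{\mathcal Y}$, and $V^\nu_y(\zeta)=\sqrt{\kappa_{\mathcal Y}}\,(\mathbf 1_{G_\zeta}(y)-\nu(G_\zeta))$. *)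

theory Defs
  imports "HOL-Analysis.Analysis" "HOL-Probability.Probability_Measure"
begin

definition borel_probs :: "'a::topological_space set \<Rightarrow> 'a measure set" where
  "borel_probs S = {\<mu>. prob_space \<mu> \<and> sets \<mu> = sets (restrict_space borel S)}"

definition couplings :: "'a measure \<Rightarrow> 'b measure \<Rightarrow> ('a \<times> 'b) measure set" where
  "couplings \<mu> \<nu> = {\<gamma>. sets \<gamma> = sets (\<mu> \<Otimes>\<^sub>M \<nu>) \<and> distr \<gamma> \<mu> fst = \<mu> \<and> distr \<gamma> \<nu> snd = \<nu>}"

definition GW_sq :: "'a::metric_space measure \<Rightarrow> 'b::metric_space measure \<Rightarrow> real" where
  "GW_sq \<mu> \<nu> = (INF \<gamma>\<in>couplings \<mu> \<nu>.
     \<integral>(x, y). (\<integral>(x', y'). \<bar>dist x x' - dist y y'\<bar>\<^sup>2 \<partial>\<gamma>) \<partial>\<gamma>)"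

definition transport_cost :: "('a \<times> 'b \<Rightarrow> real) \<Rightarrow> 'a measure \<Rightarrow> 'b measure \<Rightarrow> real" where
  "transport_cost c \<mu> \<nu> = (INF \<pi>\<in>couplings \<mu> \<nu>. \<integral>p. c p \<partial>\<pi>)"


text \<open>
  The uniform probability measure on the unit sphere is the image of the uniform distribution
  on the punctured unit ball under radial projection.
\<close>

definition uniform_sphere :: "(real ^ 'n) measure" where
  "uniform_sphere =
     distr (uniform_measure (restrict_space lborel (cball 0 1 - {0})) (cball 0 1 - {0}))
           (restrict_space borel (sphere 0 1)) sgn"

text \<open>
  The coordinates of a finite index type carry no order; the choice of the coordinate is
  irrelevant, see \<open>mean_abs_coord_eq\<close> below.
\<close>

definition mean_abs_coord :: "'n::finite itself \<Rightarrow> real" where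
  "mean_abs_coord _ = (\<integral>\<theta>. \<bar>(\<theta> :: real ^ 'n) $ (SOME i. True)\<bar> \<partial>uniform_sphere)"

lemma sgn_measurable_punctured_ball:
  "sgn \<in> restrict_space lborel (cball 0 1 - {0 :: real ^ 'n}) \<rightarrow>\<^sub>M restrict_space borel (sphere 0 1)"
proof (rule measurable_restrict_space2)
  show "sgn \<in> space (restrict_space lborel (cball 0 1 - {0 :: real ^ 'n})) \<rightarrow> sphere 0 1"
    by (auto simp: space_restrict_space norm_sgn)
  show "sgn \<in> borel_measurable (restrict_space lborel (cball 0 1 - {0 :: real ^ 'n}))"
    unfolding sgn_div_norm by (rule measurable_restrict_space1) simp
qed

lemma measurable_uniform_sphere_aux:
  "sgn \<in> uniform_measure (restrict_space lborel (cball 0 1 - {0 :: real ^ 'n})) (cball 0 1 - {0})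
     \<rightarrow>\<^sub>M restrict_space borel (sphere 0 1)"
  using sgn_measurable_punctured_ball by (subst measurable_cong_sets[OF sets_uniform_measure refl])

lemma emeasure_punctured_ball:
  "emeasure (restrict_space lborel (cball 0 1 - {0 :: real ^ 'n})) (cball 0 1 - {0}) \<noteq> 0"
  "emeasure (restrict_space lborel (cball 0 1 - {0 :: real ^ 'n})) (cball 0 1 - {0}) \<noteq> \<infinity>"
proof -
  have "emeasure lborel (cball 0 1 - {0 :: real ^ 'n}) = emeasure lborel (cball 0 1 :: (real ^ 'n) set)"
    by (subst emeasure_Diff) auto
  moreover have "emeasure lborel (cball 0 1 :: (real ^ 'n) set) \<noteq> \<infinity>"
    using emeasure_lborel_cball_finite[of "0 :: real ^ 'n" 1] by simp
  moreover have "emeasure lborel (cball 0 1 :: (real ^ 'n) set) \<noteq> 0"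
    using content_cball_pos[of 1 "0 :: real ^ 'n"] by (auto simp: measure_def)
  ultimately show "emeasure (restrict_space lborel (cball 0 1 - {0 :: real ^ 'n})) (cball 0 1 - {0}) \<noteq> 0"
    "emeasure (restrict_space lborel (cball 0 1 - {0 :: real ^ 'n})) (cball 0 1 - {0}) \<noteq> \<infinity>"
    by (simp_all add: emeasure_restrict_space)
qed

lemma prob_space_uniform_sphere: "prob_space (uniform_sphere :: (real ^ 'n) measure)"
  unfolding uniform_sphere_def
proof (rule prob_space.prob_space_distr)
  show "prob_space (uniform_measure (restrict_space lborel (cball 0 1 - {0 :: real ^ 'n})) (cball 0 1 - {0}))"
    using emeasure_punctured_ball by (rule prob_space_uniform_measure)
qed (simp add: measurable_uniform_sphere_aux)

lemma sets_uniform_sphere [simp]: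
  "sets (uniform_sphere :: (real ^ 'n) measure) = sets (restrict_space borel (sphere 0 1))"
  by (simp add: uniform_sphere_def)

lemma space_uniform_sphere [simp]:
  "space (uniform_sphere :: (real ^ 'n) measure) = sphere 0 1"
  by (simp add: uniform_sphere_def space_restrict_space)

lemma emeasure_uniform_sphere:
  assumes "A \<in> sets borel" "A \<subseteq> sphere (0 :: real ^ 'n) 1"
  shows "emeasure uniform_sphere A =
    emeasure lborel {x \<in> cball 0 1 - {0}. sgn x \<in> A} / emeasure lborel (cball 0 1 - {0 :: real ^ 'n})"
proof -
  let ?N = "restrict_space lborel (cball 0 1 - {0 :: real ^ 'n})"
  have A: "A \<in> sets (restrict_space borel (sphere 0 1))"
    using assms by (subst sets_restrict_space_iff) auto
  have B: "sgn -` A \<inter> (cball 0 1 - {0}) \<in> sets ?N"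
    using measurable_sets[OF sgn_measurable_punctured_ball A] by (simp add: space_restrict_space)
  have C: "(cball 0 1 - {0}) \<inter> (sgn -` A \<inter> (cball 0 1 - {0})) = {x \<in> cball 0 1 - {0}. sgn x \<in> A}"
    by auto
  have D: "cball 0 1 - {0} \<in> sets ?N"
    by (subst sets_restrict_space_iff) auto
  have "emeasure uniform_sphere A =
      emeasure (uniform_measure ?N (cball 0 1 - {0})) (sgn -` A \<inter> (cball 0 1 - {0}))"
    unfolding uniform_sphere_def using measurable_uniform_sphere_aux A
    by (subst emeasure_distr) (auto simp: space_restrict_space)
  also have "\<dots> = emeasure ?N {x \<in> cball 0 1 - {0}. sgn x \<in> A} / emeasure ?N (cball 0 1 - {0})"
    using D B by (subst emeasure_uniform_measure) (auto simp: C)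
  also have "\<dots> = emeasure lborel {x \<in> cball 0 1 - {0}. sgn x \<in> A} / emeasure lborel (cball 0 1 - {0 :: real ^ 'n})"
    by (subst (1 2) emeasure_restrict_space) auto
  finally show ?thesis .
qed

lemma nn_integral_lborel_translate:
  fixes f :: "'a::euclidean_space \<Rightarrow> ennreal"
  assumes [measurable]: "f \<in> borel_measurable borel"
  shows "(\<integral>\<^sup>+x. f (c + x) \<partial>lborel) = (\<integral>\<^sup>+x. f x \<partial>lborel)"
  by (subst (2) lborel_distr_plus[of c, symmetric]) (simp add: nn_integral_distr)

lemma lborel_distr_orthogonal:
  fixes T :: "'a::euclidean_space \<Rightarrow> 'a"
  assumes T: "orthogonal_transformation T"
  shows "distr lborel borel T = lborel"
proof (rule measure_eqI)
  fix A assume "A \<in> sets (distr lborel borel T)"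
  then have A [measurable]: "A \<in> sets borel" by simp
  have lin: "linear T" and n: "norm (T x) = norm x" for x
    using T by (auto simp: orthogonal_transformation)
  have [measurable]: "T \<in> borel_measurable borel"
    using lin by (intro borel_measurable_continuous_onI)
      (simp add: linear_continuous_on linear_conv_bounded_linear)
  define f g :: "'a \<Rightarrow> ennreal" where "f = indicator A" and "g = indicator (cball 0 1)"
  have [measurable]: "f \<in> borel_measurable borel" "g \<in> borel_measurable borel"
    unfolding f_def g_def by (auto intro!: borel_measurable_indicator)
  have gT: "g (- T x) = g x" for x by (simp add: g_def indicator_def n)
  let ?c = "\<integral>\<^sup>+y. g y \<partial>lborel"
  have c: "?c \<noteq> 0" "?c \<noteq> \<infinity>"
    using emeasure_lborel_cball_finite[of "0::'a" 1] content_cball_pos[of 1 "0::'a"]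
    by (auto simp: g_def measure_def)
  have "(\<integral>\<^sup>+x. f (T x) \<partial>lborel) * ?c = (\<integral>\<^sup>+x. (\<integral>\<^sup>+y. f (T x) * g (- T x + y) \<partial>lborel) \<partial>lborel)"
    by (simp add: nn_integral_cmult nn_integral_multc nn_integral_lborel_translate del: uminus_add_conv_diff)
  also have "\<dots> = (\<integral>\<^sup>+y. (\<integral>\<^sup>+x. f (T x) * g (- T x + y) \<partial>lborel) \<partial>lborel)"
    by (intro lborel_pair.Fubini') measurable
  also have "\<dots> = (\<integral>\<^sup>+y. (\<integral>\<^sup>+x. f (y + T x) * g x \<partial>lborel) \<partial>lborel)"
  proof (rule nn_integral_cong)
    fix y
    obtain z where z: "T z = y"
      using orthogonal_transformation_surj[OF T] by (metis surjD)
    have "(\<integral>\<^sup>+x. f (T x) * g (- T x + y) \<partial>lborel) = (\<integral>\<^sup>+x. f (T (z + x)) * g (- T (z + x) + y) \<partial>lborel)"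
      by (rule nn_integral_lborel_translate[symmetric]) measurable
    also have "\<dots> = (\<integral>\<^sup>+x. f (y + T x) * g x \<partial>lborel)"
      by (simp add: linear_add[OF lin] z gT)
    finally show "(\<integral>\<^sup>+x. f (T x) * g (- T x + y) \<partial>lborel) = (\<integral>\<^sup>+x. f (y + T x) * g x \<partial>lborel)" .
  qed
  also have "\<dots> = (\<integral>\<^sup>+x. (\<integral>\<^sup>+y. f (T x + y) * g x \<partial>lborel) \<partial>lborel)"
    by (subst lborel_pair.Fubini') (simp_all add: add.commute)
  also have "\<dots> = (\<integral>\<^sup>+x. f x \<partial>lborel) * ?c"
    by (simp add: nn_integral_cmult nn_integral_multc nn_integral_lborel_translate)
  finally have "(\<integral>\<^sup>+x. f (T x) \<partial>lborel) = (\<integral>\<^sup>+x. f x \<partial>lborel)"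
    using c by (metis mult_divide_eq_ennreal infinity_ennreal_def)
  moreover have "(\<integral>\<^sup>+x. f (T x) \<partial>lborel) = (\<integral>\<^sup>+x. f x \<partial>distr lborel borel T)"
    by (simp add: nn_integral_distr)
  ultimately show "emeasure (distr lborel borel T) A = emeasure lborel A"
    by (simp add: f_def)
qed simp
lemma uniform_sphere_invariant:
  fixes T :: "real ^ 'n \<Rightarrow> real ^ 'n"
  assumes T: "orthogonal_transformation T"
  shows "distr uniform_sphere uniform_sphere T = uniform_sphere"
proof (rule measure_eqI)
  have lin: "linear T" and n: "norm (T x) = norm x" for x
    using T by (auto simp: orthogonal_transformation)
  have cont: "continuous_on UNIV T" 
    using lin by (simp add: linear_continuous_on linear_conv_bounded_linear)
  have Tm: "T \<in> uniform_sphere \<rightarrow>\<^sub>M uniform_sphere"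
    unfolding measurable_cong_sets[OF sets_uniform_sphere sets_uniform_sphere]
    by (intro measurable_restrict_space3 borel_measurable_continuous_onI cont) (auto simp: n)
  show "sets (distr uniform_sphere uniform_sphere T) = sets uniform_sphere" by simp
  fix A assume "A \<in> sets (distr uniform_sphere uniform_sphere T)"
  then have "A \<in> sets (restrict_space borel (sphere (0 :: real ^ 'n) 1))" by simp
  then have A: "A \<in> sets borel" "A \<subseteq> sphere 0 1"
    by (auto simp: sets_restrict_space_iff)
  let ?B = "T -` A \<inter> sphere 0 1"
  have B: "?B \<in> sets borel" "?B \<subseteq> sphere 0 1"
    using measurable_sets[OF borel_measurable_continuous_onI[OF cont] A(1)] by auto
  have sgnT: "sgn (T x) = T (sgn x)" for x
    using lin by (simp add: sgn_div_norm n linear_cmul)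
  have sgn_vim: "{x \<in> cball 0 1 - {0 :: real ^ 'n}. sgn x \<in> C} \<in> sets borel"
    if "C \<in> sets borel" for C
  proof -
    have "sgn \<in> borel_measurable (borel :: (real ^ 'n) measure)"
      unfolding sgn_div_norm by simp
    from measurable_sets[OF this that] have "(cball 0 1 - {0}) \<inter> sgn -` C \<in> sets borel"
      by auto
    then show ?thesis by (simp add: vimage_def Int_def)
  qed
  have vim: "T -` {x \<in> cball 0 1 - {0}. sgn x \<in> A} = {x \<in> cball 0 1 - {0}. sgn x \<in> ?B}" (is "T -` ?R = ?L")
    using n lin by (auto simp: sgnT norm_sgn linear_0) (metis norm_eq_zero)
  have "emeasure lborel ?R = emeasure (distr lborel borel T) ?R"
    by (simp only: lborel_distr_orthogonal[OF T])
  also have "\<dots> = emeasure lborel ?L"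
    using sgn_vim[OF A(1)] borel_measurable_continuous_onI[OF cont]
    by (subst emeasure_distr) (simp_all only: vim space_lborel space_borel Int_UNIV_right measurable_lborel1 measurable_lborel2 sets_lborel)
  finally have "emeasure lborel ?R = emeasure lborel ?L" .
  then have "emeasure uniform_sphere ?B = emeasure uniform_sphere A"
    by (simp only: emeasure_uniform_sphere[OF A] emeasure_uniform_sphere[OF B])
  then show "emeasure (distr uniform_sphere uniform_sphere T) A = emeasure uniform_sphere A"
    using Tm A by (subst emeasure_distr) (auto simp: sets_restrict_space_iff)
qed

lemma mean_abs_coord_eq:
  fixes i :: "'n::finite"
  shows "mean_abs_coord TYPE('n) = (\<integral>\<theta>. \<bar>(\<theta> :: real ^ 'n) $ i\<bar> \<partial>uniform_sphere)"
proof -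
  define j where "j = (SOME i :: 'n. True)"
  obtain T :: "real ^ 'n \<Rightarrow> real ^ 'n" where T: "orthogonal_transformation T" "T (axis i 1) = axis j 1"
    using orthogonal_transformation_exists[of "axis i (1::real)" "axis j (1::real)"] by (auto simp: norm_axis_1)
  have c: "T \<theta> $ j = \<theta> $ i" for \<theta>
    using T by (metis cart_eq_inner_axis orthogonal_transformation_def)
  have "continuous_on UNIV T" using T(1) 
    by (simp add: linear_continuous_on linear_conv_bounded_linear[symmetric] orthogonal_transformation_linear)
  then have Tm: "T \<in> uniform_sphere \<rightarrow>\<^sub>M uniform_sphere"
    unfolding measurable_cong_sets[OF sets_uniform_sphere sets_uniform_sphere] using T(1)
    by (intro measurable_restrict_space3 borel_measurable_continuous_onI)
       (auto simp: orthogonal_transformation)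
  have m: "(\<lambda>\<theta>. \<bar>\<theta> $ j\<bar>) \<in> borel_measurable (uniform_sphere :: (real ^ 'n) measure)"
    unfolding measurable_cong_sets[OF sets_uniform_sphere refl]
    by (intro measurable_restrict_space1 borel_measurable_continuous_onI continuous_intros)
  have "mean_abs_coord TYPE('n) = (\<integral>\<theta>. \<bar>\<theta> $ j\<bar> \<partial>distr uniform_sphere uniform_sphere T)"
    by (simp add: mean_abs_coord_def j_def uniform_sphere_invariant[OF T(1)])
  also have "\<dots> = (\<integral>\<theta>. \<bar>T \<theta> $ j\<bar> \<partial>uniform_sphere)"
    using Tm m by (rule integral_distr)
  finally show ?thesis by (simp add: c)
qed


definition hs_kappa :: "'n::finite itself \<Rightarrow> real \<Rightarrow> real" where
  "hs_kappa _ R = 2 * R / mean_abs_coord TYPE('n)"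

definition hs_measure :: "real \<Rightarrow> ((real ^ 'n) \<times> real) measure" where
  "hs_measure R =
     density (uniform_sphere \<Otimes>\<^sub>M restrict_space lborel {-R..R}) (\<lambda>_. ennreal (1 / (2 * R)))"

definition half_space :: "(real ^ 'n) set \<Rightarrow> (real ^ 'n) \<times> real \<Rightarrow> (real ^ 'n) set" where
  "half_space S = (\<lambda>(\<theta>, t). {x \<in> S. \<theta> \<bullet> x > t})"

definition hs_embed ::
    "(real ^ 'n) set \<Rightarrow> real \<Rightarrow> (real ^ 'n) measure \<Rightarrow> real ^ 'n \<Rightarrow> (real ^ 'n) \<times> real \<Rightarrow> real" where
  "hs_embed S R \<mu> x \<xi> =
     sqrt (hs_kappa TYPE('n) R) * (indicator (half_space S \<xi>) x - measure \<mu> (half_space S \<xi>))"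


text \<open>Elements of \<open>L\<^sup>2(M)\<close> are represented by square-integrable functions.\<close>

definition L2_fun :: "'w measure \<Rightarrow> ('w \<Rightarrow> real) set" where
  "L2_fun M = {f \<in> borel_measurable M. integrable M (\<lambda>w. (f w)\<^sup>2)}"

definition L2_norm :: "'w measure \<Rightarrow> ('w \<Rightarrow> real) \<Rightarrow> real" where
  "L2_norm M f = sqrt (\<integral>w. (f w)\<^sup>2 \<partial>M)"


text \<open>
  Only the \<sigma>-algebra of \<open>N\<close> matters in the following notions. The value of \<open>\<eta>\<close> outside
  \<open>sets N\<close> is irrelevant.
\<close>

definition signed_measure :: "'p measure \<Rightarrow> ('p set \<Rightarrow> real) \<Rightarrow> bool" where
  "signed_measure N \<eta> \<longleftrightarrow> \<eta> {} = 0 \<and>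
     (\<forall>A :: nat \<Rightarrow> 'p set. range A \<subseteq> sets N \<longrightarrow> disjoint_family A \<longrightarrow>
        (\<lambda>i. \<eta> (A i)) sums \<eta> (\<Union>i. A i))"

definition total_variation :: "'p measure \<Rightarrow> ('p set \<Rightarrow> real) \<Rightarrow> 'p measure" where
  "total_variation N \<eta> = measure_of (space N) (sets N)
     (\<lambda>A. SUP P\<in>{P. finite P \<and> P \<subseteq> sets N \<and> disjoint P \<and> \<Union>P = A}. \<Sum>B\<in>P. ennreal \<bar>\<eta> B\<bar>)"

lemma emeasure_total_variation:
  assumes \<eta>: "signed_measure N \<eta>" and A: "A \<in> sets N"
  shows "emeasure (total_variation N \<eta>) A =
    (SUP P\<in>{P. finite P \<and> P \<subseteq> sets N \<and> disjoint P \<and> \<Union>P = A}. \<Sum>B\<in>P. ennreal \<bar>\<eta> B\<bar>)"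
proof -
  define Q where "Q A = {P. finite P \<and> P \<subseteq> sets N \<and> disjoint P \<and> \<Union>P = A}" for A
  define v where "v A = (SUP P\<in>Q A. \<Sum>B\<in>P. ennreal \<bar>\<eta> B\<bar>)" for A
  have \<eta>0: "\<eta> {} = 0" using \<eta> by (simp add: signed_measure_def)
  have le: "(\<Sum>B\<in>P. ennreal \<bar>\<eta> B\<bar>) \<le> v A" if "P \<in> Q A" for P A
    unfolding v_def using that by (rule SUP_upper)
  have Qne: "Q A \<noteq> {}" if "A \<in> sets N" for A
    using that by (auto simp: Q_def intro!: exI[of _ "{A}"])
  have super: "v A + v B \<le> v (A \<union> B)" if AB: "A \<in> sets N" "B \<in> sets N" "A \<inter> B = {}" for A B
  proof -
    have "(\<Sum>C\<in>P. ennreal \<bar>\<eta> C\<bar>) + (\<Sum>C\<in>R. ennreal \<bar>\<eta> C\<bar>) \<le> v (A \<union> B)" if P: "P \<in> Q A" and R: "R \<in> Q B" for P R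
    proof -
      have "P \<inter> R \<subseteq> {{}}" using P R AB(3) by (auto simp: Q_def)
      then have "(\<Sum>C\<in>P. ennreal \<bar>\<eta> C\<bar>) + (\<Sum>C\<in>R. ennreal \<bar>\<eta> C\<bar>) = (\<Sum>C\<in>P \<union> R. ennreal \<bar>\<eta> C\<bar>)"
        using P R \<eta>0 by (subst sum.union_inter_neutral) (auto simp: Q_def)
      also have "P \<union> R \<in> Q (A \<union> B)"
        using P R AB(3) by (auto simp: Q_def intro!: disjoint_union)
      then have "(\<Sum>C\<in>P \<union> R. ennreal \<bar>\<eta> C\<bar>) \<le> v (A \<union> B)" by (rule le)
      finally show ?thesis .
    qed
    then have "(\<Sum>C\<in>P. ennreal \<bar>\<eta> C\<bar>) + v B \<le> v (A \<union> B)" if "P \<in> Q A" for P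
      unfolding v_def[of B] ennreal_SUP_add_right[OF Qne[OF AB(2)]]
      using that by (blast intro: SUP_least)
    then show ?thesis
      unfolding v_def[of A] ennreal_SUP_add_left[OF Qne[OF AB(1)], symmetric]
      by (blast intro: SUP_least)
  qed
  have "measure_space (space N) (sets N) v"
    unfolding measure_space_def
  proof (intro conjI)
    show "positive (sets N) v"
    proof -
      have "(\<Sum>B\<in>P. ennreal \<bar>\<eta> B\<bar>) = 0" if "P \<in> Q {}" for P
        using that \<eta>0 by (intro sum.neutral) (auto simp: Q_def)
      then have "v {} \<le> 0" unfolding v_def by (intro SUP_least) simp
      then show ?thesis by (simp add: positive_def)
    qed
    show "countably_additive (sets N) v"
    proof (rule countably_additiveI)
      fix A :: "nat \<Rightarrow> _" assume A: "range A \<subseteq> sets N" "disjoint_family A" "\<Union> (range A) \<in> sets N"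
      have Am: "A i \<in> sets N" for i using A by auto
      show "(\<Sum>i. v (A i)) = v (\<Union> (range A))"
      proof (rule antisym)
        have fin: "(\<Sum>i<n. v (A i)) \<le> v (\<Union>i<n. A i)" for n
        proof (induction n)
          case (Suc n)
          have "(\<Sum>i<Suc n. v (A i)) \<le> v (\<Union>i<n. A i) + v (A n)" using Suc by (simp add: add_right_mono)
          also have "\<dots> \<le> v ((\<Union>i<n. A i) \<union> A n)"
          proof (rule super)
            show "(\<Union>i<n. A i) \<inter> A n = {}"
            proof -
              have "A i \<inter> A n = {}" if "i < n" for i
                using A(2) that by (intro disjoint_family_onD[of A UNIV]) auto
              then show ?thesis by auto
            qed
            show "(\<Union>i<n. A i) \<in> sets N" using Am by (intro sets.finite_UN) auto
            show "A n \<in> sets N" by (rule Am)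
          qed
          also have "(\<Union>i<n. A i) \<union> A n = (\<Union>i<Suc n. A i)" by (auto simp: lessThan_Suc)
          finally show ?case .
        qed simp
        have "v (\<Union>i<n. A i) \<le> v (\<Union> (range A))" for n
        proof -
          have "v (\<Union>i<n. A i) \<le> v (\<Union>i<n. A i) + v (\<Union> (range A) - (\<Union>i<n. A i))" by simp
          also have "\<dots> \<le> v ((\<Union>i<n. A i) \<union> (\<Union> (range A) - (\<Union>i<n. A i)))"
            using Am A(3) by (intro super) auto
          also have "(\<Union>i<n. A i) \<union> (\<Union> (range A) - (\<Union>i<n. A i)) = \<Union> (range A)" by auto
          finally show ?thesis .
        qed
        with fin show "(\<Sum>i. v (A i)) \<le> v (\<Union> (range A))"
          by (intro suminf_le_const) (auto intro: order_trans)
        show "v (\<Union> (range A)) \<le> (\<Sum>i. v (A i))"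
          unfolding v_def[of "\<Union> (range A)"]
        proof (rule SUP_least)
          fix P assume P: "P \<in> Q (\<Union> (range A))"
          have "(\<Sum>B\<in>P. ennreal \<bar>\<eta> B\<bar>) \<le> (\<Sum>B\<in>P. \<Sum>i. ennreal \<bar>\<eta> (B \<inter> A i)\<bar>)"
          proof (rule sum_mono)
            fix B assume B: "B \<in> P"
            have "(\<lambda>i. \<eta> (B \<inter> A i)) sums \<eta> (\<Union>i. B \<inter> A i)"
            proof -
              have "range (\<lambda>i. B \<inter> A i) \<subseteq> sets N" using B P Am by (auto simp: Q_def)
              moreover have "disjoint_family (\<lambda>i. B \<inter> A i)"
                by (rule disjoint_family_subset[OF A(2)]) auto
              ultimately show ?thesis using \<eta> unfolding signed_measure_def by blast
            qed
            also have "(\<Union>i. B \<inter> A i) = B" using B P by (auto simp: Q_def)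
            finally have "(\<lambda>n. ennreal \<bar>\<Sum>i<n. \<eta> (B \<inter> A i)\<bar>) \<longlonglongrightarrow> ennreal \<bar>\<eta> B\<bar>"
              unfolding sums_def by (intro tendsto_intros)
            moreover have "ennreal \<bar>\<Sum>i<n. \<eta> (B \<inter> A i)\<bar> \<le> (\<Sum>i. ennreal \<bar>\<eta> (B \<inter> A i)\<bar>)" for n
            proof -
              have "ennreal \<bar>\<Sum>i<n. \<eta> (B \<inter> A i)\<bar> \<le> (\<Sum>i<n. ennreal \<bar>\<eta> (B \<inter> A i)\<bar>)"
                by (subst sum_ennreal) (auto intro!: ennreal_leI sum_abs)
              also have "\<dots> \<le> (\<Sum>i. ennreal \<bar>\<eta> (B \<inter> A i)\<bar>)"
                by (rule sum_le_suminf) auto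
              finally show ?thesis .
            qed
            ultimately show "ennreal \<bar>\<eta> B\<bar> \<le> (\<Sum>i. ennreal \<bar>\<eta> (B \<inter> A i)\<bar>)"
              by (intro LIMSEQ_le_const2[where X = "\<lambda>n. ennreal \<bar>\<Sum>i<n. \<eta> (B \<inter> A i)\<bar>"]) blast+
          qed
          also have "\<dots> = (\<Sum>i. \<Sum>B\<in>P. ennreal \<bar>\<eta> (B \<inter> A i)\<bar>)"
            by (rule suminf_sum[symmetric]) auto
          also have "\<dots> \<le> (\<Sum>i. v (A i))"
          proof (rule suminf_le)
            fix i
            have disj: "B \<inter> A i = {}" if "B \<in> P" "C \<in> P" "B \<noteq> C" "B \<inter> A i = C \<inter> A i" for B C
            proof -
              have "B \<inter> C = {}" using that P by (auto simp: Q_def disjoint_def)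
              then show ?thesis using that(4) by blast
            qed
            have "(\<Sum>B\<in>P. ennreal \<bar>\<eta> (B \<inter> A i)\<bar>) = (\<Sum>C\<in>(\<lambda>B. B \<inter> A i) ` P. ennreal \<bar>\<eta> C\<bar>)"
            proof (subst sum.reindex_nontrivial)
              show "finite P" using P by (simp add: Q_def)
              show "ennreal \<bar>\<eta> (B \<inter> A i)\<bar> = 0"
                if "B \<in> P" "C \<in> P" "B \<noteq> C" "B \<inter> A i = C \<inter> A i" for B C
                using disj[OF that] \<eta>0 by simp
            qed simp
            also have "\<dots> \<le> v (A i)"
              using P Am[of i] by (intro le) (auto simp: Q_def disjoint_def)
            finally show "(\<Sum>B\<in>P. ennreal \<bar>\<eta> (B \<inter> A i)\<bar>) \<le> v (A i)" .
          qed auto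
          finally show "(\<Sum>B\<in>P. ennreal \<bar>\<eta> B\<bar>) \<le> (\<Sum>i. v (A i))" .
        qed
      qed
    qed
  qed (rule sets.sigma_algebra_axioms)
  moreover have "total_variation N \<eta> = measure_of (space N) (sets N) v"
    unfolding total_variation_def v_def Q_def ..
  ultimately have "emeasure (total_variation N \<eta>) A = v A"
    using A by (simp add: emeasure_measure_of_sigma measure_space_def)
  then show ?thesis unfolding v_def Q_def .
qed

definition TV_norm :: "'p measure \<Rightarrow> ('p set \<Rightarrow> real) \<Rightarrow> ennreal" where
  "TV_norm N \<eta> = emeasure (total_variation N \<eta>) (space N)"

text \<open>
  \<open>has_L2_bochner_integral M N \<eta> F b\<close>: the map \<open>F\<close> into \<open>L\<^sup>2(M)\<close> is Bochner integrable with respect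
  to the finite signed measure \<open>\<eta>\<close>, and \<open>b\<close> represents \<open>\<integral> F d\<eta>\<close>. As \<open>L\<^sup>2(M)\<close> is not a type,
  this spells out the definition by \<open>L\<^sup>2(M)\<close>-valued simple functions \<open>s n\<close>, which converge to \<open>F\<close>
  almost everywhere and in mean, and whose integrals converge to \<open>b\<close> in \<open>L\<^sup>2(M)\<close>.
\<close>

definition has_L2_bochner_integral ::
    "'w measure \<Rightarrow> 'p measure \<Rightarrow> ('p set \<Rightarrow> real) \<Rightarrow> ('p \<Rightarrow> 'w \<Rightarrow> real) \<Rightarrow> ('w \<Rightarrow> real) \<Rightarrow> bool" where
  "has_L2_bochner_integral M N \<eta> F b \<longleftrightarrow>
     b \<in> L2_fun M \<and> (\<forall>p\<in>space N. F p \<in> L2_fun M) \<and>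
     (\<exists>s :: nat \<Rightarrow> 'p \<Rightarrow> 'w \<Rightarrow> real.
        (\<forall>n. simple_function N (s n) \<and> (\<forall>p\<in>space N. s n p \<in> L2_fun M)) \<and>
        (AE p in total_variation N \<eta>. (\<lambda>n. L2_norm M (\<lambda>w. F p w - s n p w)) \<longlonglongrightarrow> 0) \<and>
        (\<lambda>n. \<integral>\<^sup>+p. ennreal (L2_norm M (\<lambda>w. F p w - s n p w)) \<partial>total_variation N \<eta>) \<longlonglongrightarrow> 0 \<and>
        (\<lambda>n. L2_norm M (\<lambda>w. b w - (\<Sum>f\<in>s n ` space N. \<eta> {p \<in> space N. s n p = f} * f w)))
          \<longlonglongrightarrow> 0)"


definition GW_const :: "'a::metric_space measure \<Rightarrow> 'b::metric_space measure \<Rightarrow> real" where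
  "GW_const \<mu> \<nu> =
     (\<integral>x. (\<integral>x'. (dist x x')\<^sup>2 \<partial>\<mu>) \<partial>\<mu>) + (\<integral>y. (\<integral>y'. (dist y y')\<^sup>2 \<partial>\<nu>) \<partial>\<nu>)
     - (\<integral>x. (\<integral>x'. dist x x' \<partial>\<mu>) \<partial>\<mu>) * (\<integral>y. (\<integral>y'. dist y y' \<partial>\<nu>) \<partial>\<nu>)"

definition hs_prod_measure ::
    "real \<Rightarrow> real \<Rightarrow> (((real ^ 'm) \<times> real) \<times> ((real ^ 'n) \<times> real)) measure" where
  "hs_prod_measure RX RY = hs_measure RX \<Otimes>\<^sub>M hs_measure RY"

definition hs_pair ::
    "(real ^ 'm) set \<Rightarrow> (real ^ 'n) set \<Rightarrow> (real ^ 'm) \<times> (real ^ 'n) \<Rightarrow>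
     ((real ^ 'm) \<times> real) \<times> ((real ^ 'n) \<times> real) \<Rightarrow> real" where
  "hs_pair X Y = (\<lambda>(u, v) (\<xi>, \<zeta>). indicator (half_space X \<xi>) u * indicator (half_space Y \<zeta>) v)"

definition dual_set ::
    "(real ^ 'm) set \<Rightarrow> (real ^ 'n) set \<Rightarrow> real \<Rightarrow> real \<Rightarrow>
     (((real ^ 'm) \<times> real) \<times> ((real ^ 'n) \<times> real) \<Rightarrow> real) set" where
  "dual_set X Y RX RY =
     {\<lambda>w. 8 * sqrt (hs_kappa TYPE('m) RX * hs_kappa TYPE('n) RY) * b w | b \<eta>.
        signed_measure (restrict_space borel (X \<times> Y)) \<eta> \<and>
        TV_norm (restrict_space borel (X \<times> Y)) \<eta> \<le> 2 \<and>
        has_L2_bochner_integral (hs_prod_measure RX RY) (restrict_space borel (X \<times> Y)) \<eta>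
          (hs_pair X Y) b}"

lemma dual_set_subset_L2: "dual_set X Y RX RY \<subseteq> L2_fun (hs_prod_measure RX RY)"
  by (auto simp: dual_set_def has_L2_bochner_integral_def L2_fun_def power_mult_distrib)

lemma prob_space_hs_measure:
  assumes "R > 0"
  shows "prob_space (hs_measure R :: ((real ^ 'n) \<times> real) measure)"
proof
  let ?I = "restrict_space lborel {-R..R}"
  interpret S: prob_space "uniform_sphere :: (real ^ 'n) measure" by (rule prob_space_uniform_sphere)
  have I: "emeasure ?I {-R..R} = ennreal (2 * R)"
    using assms by (simp add: emeasure_restrict_space)
  interpret I: finite_measure ?I
    using I by (intro finite_measureI) (simp add: space_restrict_space)
  have "emeasure ((uniform_sphere :: (real ^ 'n) measure) \<Otimes>\<^sub>M ?I) (space (uniform_sphere \<Otimes>\<^sub>M ?I)) = ennreal (2 * R)"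
    unfolding space_pair_measure
    using S.emeasure_space_1 I
    by (subst I.emeasure_pair_measure_Times[OF sets.top sets.top]) (simp add: space_restrict_space)
  then show "emeasure (hs_measure R :: ((real ^ 'n) \<times> real) measure) (space (hs_measure R)) = 1"
    using assms unfolding hs_measure_def
    by (simp add: emeasure_density_const sets.top ennreal_mult[symmetric] del: sets_uniform_sphere)
qed

definition dual_cost ::
    "(real ^ 'm) set \<Rightarrow> (real ^ 'n) set \<Rightarrow> real \<Rightarrow> real \<Rightarrow>
     (((real ^ 'm) \<times> real) \<times> ((real ^ 'n) \<times> real) \<Rightarrow> real) \<Rightarrow>
     (real ^ 'm) measure \<Rightarrow> (real ^ 'n) measure \<Rightarrow> (real ^ 'm) \<times> (real ^ 'n) \<Rightarrow> real" where
  "dual_cost X Y RX RY a \<mu> \<nu> = (\<lambda>(x, y).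
     - 4 * (L2_norm (hs_measure RX) (hs_embed X RX \<mu> x))\<^sup>2 * (L2_norm (hs_measure RY) (hs_embed Y RY \<nu> y))\<^sup>2
     - 2 * (\<integral>(\<xi>, \<zeta>). a (\<xi>, \<zeta>) * hs_embed X RX \<mu> x \<xi> * hs_embed Y RY \<nu> y \<zeta> \<partial>hs_prod_measure RX RY))"

end

theory Submission
  imports Defs
begin

text \<open>
  Half-spaces turn distances into Hilbert space geometry. The half-spaces that separate two points
  have measure proportional to the distance of the points (\<open>halfspace_distance_eq\<close>), so with the
  right scaling \<open>dist x x' = \<parallel>U x - U x'\<parallel>\<^sup>2\<close> for the centred half-space embedding \<open>U\<close>, and likewise
  \<open>dist y y' = \<parallel>V y - V y'\<parallel>\<^sup>2\<close>. Centring means that \<open>\<integral> U d\<mu> = 0\<close> and \<open>\<integral> V d\<nu> = 0\<close>.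

  Let \<open>\<gamma>\<close> be a coupling of \<open>\<mu>\<close> and \<open>\<nu>\<close>. In the expansion of the double integral of
  \<open>(dist x x' - dist y y')\<^sup>2\<close> the terms that are not determined by the marginals are, thanks to
  centring, only \<open>- 4 \<integral> \<parallel>U x\<parallel>\<^sup>2 \<parallel>V y\<parallel>\<^sup>2 d\<gamma>\<close> and \<open>- 8 \<parallel>m\<parallel>\<^sup>2\<close>, where \<open>m = \<integral> U x \<otimes> V y d\<gamma>\<close> is the cross moment
  (\<open>integral_squared_difference\<close>). The concave term is the infimum of affine ones,
  \<open>- 8 \<parallel>m\<parallel>\<^sup>2 = inf\<^sub>a (\<parallel>a\<parallel>\<^sup>2 / 8 - 2 \<langle>a, m\<rangle>)\<close>, attained at \<open>a = 8 m\<close> (\<open>L2_conjugate_square\<close>). For fixed \<open>a\<close>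
  what remains is linear in \<open>\<gamma>\<close>: it is the integral of the dual cost. So the
  Gromov--Wasserstein objective of \<open>\<gamma>\<close> is the minimum over \<open>a\<close> of the dual objective (\<open>dual_objective_eq\<close>),
  and the theorem follows by exchanging two infima.

  The set over which \<open>a\<close> ranges must contain the minimisers \<open>8 m\<close>. It does, because centring amounts to
  subtracting the product measure: \<open>m\<close> is the integral of the uncentred indicators of products of half-spaces
  against \<open>\<gamma> - \<mu> \<otimes> \<nu>\<close>, a signed measure of total variation at most \<open>2\<close>
  (\<open>cross_moment_in_dual_set\<close>). That this integral exists in the sense of Bochner follows from the
  Hoelder continuity of the indicators as elements of \<open>L\<^sup>2\<close> (\<open>has_L2_bochner_integral_diff\<close>).
\<close>

section \<open>Averages of functions and centred maps into \<open>L\<^sup>2\<close>\<close>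

lemma (in prob_space) integrable_bounded:
  fixes f :: "'a \<Rightarrow> real"
  assumes "f \<in> borel_measurable M" "\<And>x. x \<in> space M \<Longrightarrow> \<bar>f x\<bar> \<le> C"
  shows "integrable M f"
  using assms by (intro integrable_const_bound[of f C]) auto

lemma abs_square_bounded:
  fixes x :: real
  assumes "\<bar>x\<bar> \<le> C"
  shows "\<bar>x\<^sup>2\<bar> \<le> C\<^sup>2"
  using power_mono[OF assms abs_ge_zero, of 2] by simp

lemma (in prob_space) abs_integral_bounded:
  fixes f :: "'a \<Rightarrow> real"
  assumes "\<And>x. x \<in> space M \<Longrightarrow> \<bar>f x\<bar> \<le> C" "0 \<le> C"
  shows "\<bar>\<integral>x. f x \<partial>M\<bar> \<le> C"
proof (cases "integrable M f")
  case True
  then have "\<bar>\<integral>x. f x \<partial>M\<bar> \<le> (\<integral>x. C \<partial>M)"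
    using assms by (intro order_trans[OF integral_abs_bound integral_mono]) auto
  then show ?thesis by (simp add: prob_space)
qed (simp add: not_integrable_integral_eq assms)

text \<open>
  Pairing a fixed \<open>a \<in> L\<^sup>1(W)\<close> with a random bounded function \<open>g p\<close> commutes with averaging over
  \<open>p\<close>: this is Fubini's theorem, where \<open>C \<bar>a w\<bar>\<close> dominates the integrand on the product space.
\<close>

lemma integral_mult_mixture:
  fixes a :: "'w \<Rightarrow> real" and g :: "'p \<Rightarrow> 'w \<Rightarrow> real"
  assumes "prob_space P" "prob_space W"
    and [measurable]: "case_prod g \<in> borel_measurable (P \<Otimes>\<^sub>M W)" and bnd: "\<And>p w. \<bar>g p w\<bar> \<le> C"
    and a: "integrable W a"
  shows "(\<integral>p. (\<integral>w. a w * g p w \<partial>W) \<partial>P) = (\<integral>w. a w * (\<integral>p. g p w \<partial>P) \<partial>W)"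
proof -
  interpret P: prob_space P by fact
  interpret W: prob_space W by fact
  interpret PW: pair_prob_space P W ..
  note [measurable] = borel_measurable_integrable[OF a]
  have "integrable (P \<Otimes>\<^sub>M W) (\<lambda>(p, w). a w * g p w)"
  proof (rule Bochner_Integration.integrable_bound)
    have "integrable (P \<Otimes>\<^sub>M W) (\<lambda>(p, w). a w)"
      by (rule PW.Fubini_integrable) (use a in auto)
    then show "integrable (P \<Otimes>\<^sub>M W) (\<lambda>(p, w). C * a w)"
      unfolding split_beta by (rule integrable_mult_right)
    have "\<bar>a w * g p w\<bar> \<le> \<bar>C * a w\<bar>" for p w
      using mult_left_mono[OF order_trans[OF bnd abs_ge_self], of "\<bar>a w\<bar>" p w]
      by (simp add: abs_mult mult.commute)
    then show "AE x in P \<Otimes>\<^sub>M W. norm (case x of (p, w) \<Rightarrow> a w * g p w) \<le> norm (case x of (p, w) \<Rightarrow> C * a w)"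
      by (auto simp: split_beta)
  qed measurable
  from PW.Fubini_integral[OF this] show ?thesis by simp
qed

text \<open>
  The squared \<open>L\<^sup>2\<close> norm of an average of functions is the double average of their inner products.
  This turns the term \<open>\<integral>\<integral> k(x,x') l(y,y') d\<gamma> d\<gamma>\<close>, quadratic in a coupling \<open>\<gamma>\<close>, into a squared norm.
\<close>

lemma integral_gram_kernel:
  fixes g :: "'p \<Rightarrow> 'w \<Rightarrow> real"
  assumes "prob_space P" "prob_space W"
    and g[measurable]: "case_prod g \<in> borel_measurable (P \<Otimes>\<^sub>M W)" and bnd: "\<And>p w. \<bar>g p w\<bar> \<le> C"
  shows "(\<integral>p. (\<integral>p'. (\<integral>w. g p w * g p' w \<partial>W) \<partial>P) \<partial>P) = (\<integral>w. (\<integral>p. g p w \<partial>P)\<^sup>2 \<partial>W)"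
proof -
  interpret P: prob_space P by fact
  interpret W: prob_space W by fact
  have C: "0 \<le> C" using order_trans[OF abs_ge_zero bnd] .
  define m where "m w = (\<integral>p. g p w \<partial>P)" for w
  have [measurable]: "m \<in> borel_measurable W"
    unfolding m_def by measurable
  have m: "integrable W m"
    by (rule W.integrable_bounded[of _ C]) (auto simp: m_def intro!: P.abs_integral_bounded bnd C)
  have "(\<integral>p'. (\<integral>w. g p w * g p' w \<partial>W) \<partial>P) = (\<integral>w. m w * g p w \<partial>W)" if p: "p \<in> space P" for p
  proof -
    have [measurable]: "g p \<in> borel_measurable W"
      using measurable_compose[OF measurable_Pair1'[OF p] g] by simp
    have "integrable W (g p)" by (rule W.integrable_bounded[of _ C]) (auto intro: bnd)
    from integral_mult_mixture[OF assms(1,2) g bnd this] show ?thesis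
      by (simp add: m_def mult.commute)
  qed
  then have "(\<integral>p. (\<integral>p'. (\<integral>w. g p w * g p' w \<partial>W) \<partial>P) \<partial>P) = (\<integral>p. (\<integral>w. m w * g p w \<partial>W) \<partial>P)"
    by (intro Bochner_Integration.integral_cong) auto
  also have "\<dots> = (\<integral>w. m w * (\<integral>p. g p w \<partial>P) \<partial>W)"
    by (rule integral_mult_mixture[OF assms(1,2) g bnd m])
  finally show ?thesis by (simp add: m_def power2_eq_square)
qed

text \<open>
  A map \<open>x \<mapsto> u x\<close> from a probability space \<open>M\<close> into \<open>L\<^sup>2(W)\<close> with mean zero. The points of \<open>L\<^sup>2(W)\<close>
  are genuine functions, jointly measurable in both arguments, and the mean vanishes pointwise.
  The uniform bound makes every integral below finite; it is demanded at all arguments, so that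
  integrability is a matter of measurability only.
\<close>

locale centered_feature_map = M: prob_space M + W: prob_space W
  for M :: "'a measure" and W :: "'w measure" +
  fixes u :: "'a \<Rightarrow> 'w \<Rightarrow> real" and C :: real
  assumes measurable_u [measurable]: "case_prod u \<in> borel_measurable (M \<Otimes>\<^sub>M W)"
    and bounded: "\<bar>u x w\<bar> \<le> C"
    and centered: "w \<in> space W \<Longrightarrow> (\<integral>x. u x w \<partial>M) = 0"
begin

definition gram :: "'a \<Rightarrow> 'a \<Rightarrow> real" where
  "gram x x' = (\<integral>w. u x w * u x' w \<partial>W)"

lemma C_nonneg: "0 \<le> C" using order_trans[OF abs_ge_zero bounded] .

lemma measurable_gram [measurable]: "case_prod gram \<in> borel_measurable (M \<Otimes>\<^sub>M M)"
  unfolding gram_def by measurable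

lemma measurable_section [measurable]: "x \<in> space M \<Longrightarrow> u x \<in> borel_measurable W"
  using measurable_compose[OF measurable_Pair1' measurable_u] by simp

lemma bounded_prod: "\<bar>u x w * u x' w'\<bar> \<le> C * C"
  by (simp add: abs_mult mult_mono bounded C_nonneg)

lemma integrable_prod: "x \<in> space M \<Longrightarrow> x' \<in> space M \<Longrightarrow> integrable W (\<lambda>w. u x w * u x' w)"
  by (rule W.integrable_bounded[OF _ bounded_prod]) simp

lemma gram_bounded: "\<bar>gram x x'\<bar> \<le> C * C"
  unfolding gram_def by (rule W.abs_integral_bounded) (auto intro: bounded_prod C_nonneg)

lemma gram_commute: "gram x x' = gram x' x"
  by (simp add: gram_def mult.commute)

text \<open>
  Averaging an inner product over its second argument pairs with the mean, which is zero. This kills the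
  terms with exactly one Gram kernel when a product of two squared distances is expanded.
\<close>

lemma gram_centered:
  assumes x: "x \<in> space M"
  shows "(\<integral>x'. gram x x' \<partial>M) = 0"
proof -
  have "integrable W (u x)" using x by (intro W.integrable_bounded[of _ C]) (auto intro: bounded)
  from integral_mult_mixture[OF M.prob_space_axioms W.prob_space_axioms measurable_u bounded this]
  have "(\<integral>x'. gram x x' \<partial>M) = (\<integral>w. u x w * (\<integral>x. u x w \<partial>M) \<partial>W)" by (simp add: gram_def)
  also have "\<dots> = (\<integral>w. 0 \<partial>W)" by (intro Bochner_Integration.integral_cong) (auto simp: centered)
  finally show ?thesis by simp
qed

lemma squared_distance_gram:
  assumes "x \<in> space M" "x' \<in> space M"
  shows "(\<integral>w. (u x w - u x' w)\<^sup>2 \<partial>W) = gram x x + gram x' x' - 2 * gram x x'"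
proof -
  have "(\<integral>w. (u x w - u x' w)\<^sup>2 \<partial>W)
      = (\<integral>w. u x w * u x w + u x' w * u x' w - 2 * (u x w * u x' w) \<partial>W)"
    by (simp add: power2_eq_square algebra_simps)
  also have "\<dots> = gram x x + gram x' x' - 2 * gram x x'"
    using assms by (simp add: integrable_prod gram_def)
  finally show ?thesis .
qed

end

section \<open>The Gromov--Wasserstein objective of a coupling\<close>

text \<open>
  That \<open>\<gamma>\<close> is a probability measure is inherited from its first marginal.
\<close>

lemma couplingsD:
  assumes "prob_space \<mu>" and \<gamma>: "\<gamma> \<in> couplings \<mu> \<nu>"
  shows "prob_space \<gamma>" "sets \<gamma> = sets (\<mu> \<Otimes>\<^sub>M \<nu>)" "space \<gamma> = space \<mu> \<times> space \<nu>"
    "fst \<in> \<gamma> \<rightarrow>\<^sub>M \<mu>" "snd \<in> \<gamma> \<rightarrow>\<^sub>M \<nu>" "distr \<gamma> \<mu> fst = \<mu>" "distr \<gamma> \<nu> snd = \<nu>"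
proof -
  show sets: "sets \<gamma> = sets (\<mu> \<Otimes>\<^sub>M \<nu>)" and d: "distr \<gamma> \<mu> fst = \<mu>" "distr \<gamma> \<nu> snd = \<nu>"
    using \<gamma> by (auto simp: couplings_def)
  show "space \<gamma> = space \<mu> \<times> space \<nu>"
    using sets_eq_imp_space_eq[OF sets] by (simp add: space_pair_measure)
  show f: "fst \<in> \<gamma> \<rightarrow>\<^sub>M \<mu>" and "snd \<in> \<gamma> \<rightarrow>\<^sub>M \<nu>"
    by (simp_all add: measurable_cong_sets[OF sets refl])
  from f d assms(1) show "prob_space \<gamma>"
    by (metis prob_space_distrD)
qed

lemma integral_coupling_fst:
  fixes f :: "'a \<Rightarrow> real"
  assumes "prob_space \<mu>" "\<gamma> \<in> couplings \<mu> \<nu>" "f \<in> borel_measurable \<mu>"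
  shows "(\<integral>p. f (fst p) \<partial>\<gamma>) = (\<integral>x. f x \<partial>\<mu>)"
  using integral_distr[OF couplingsD(4)[OF assms(1,2)] assms(3)] couplingsD(6)[OF assms(1,2)] by simp

lemma integral_coupling_snd:
  fixes f :: "'a \<Rightarrow> real"
  assumes "prob_space \<mu>" "\<gamma> \<in> couplings \<mu> \<nu>" "f \<in> borel_measurable \<nu>"
  shows "(\<integral>p. f (snd p) \<partial>\<gamma>) = (\<integral>y. f y \<partial>\<nu>)"
  using integral_distr[OF couplingsD(5)[OF assms(1,2)] assms(3)] couplingsD(7)[OF assms(1,2)] by simp

lemma pair_measure_in_couplings:
  assumes "prob_space \<mu>" "prob_space \<nu>"
  shows "\<mu> \<Otimes>\<^sub>M \<nu> \<in> couplings \<mu> \<nu>"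
proof -
  interpret M: prob_space \<mu> by fact
  interpret N: prob_space \<nu> by fact
  interpret pair_prob_space \<mu> \<nu> ..
  have "distr (\<mu> \<Otimes>\<^sub>M \<nu>) \<nu> snd = \<nu>"
  proof (rule measure_eqI)
    fix A assume "A \<in> sets (distr (\<mu> \<Otimes>\<^sub>M \<nu>) \<nu> snd)"
    then have A: "A \<in> sets \<nu>" by simp
    then have "snd -` A \<inter> space (\<mu> \<Otimes>\<^sub>M \<nu>) = space \<mu> \<times> A"
      using sets.sets_into_space[OF A] by (auto simp: space_pair_measure)
    then show "emeasure (distr (\<mu> \<Otimes>\<^sub>M \<nu>) \<nu> snd) A = emeasure \<nu> A"
      using A by (simp add: emeasure_distr N.emeasure_pair_measure_Times M.emeasure_space_1)
  qed simp
  moreover have "distr (\<mu> \<Otimes>\<^sub>M \<nu>) \<mu> fst = \<mu>"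
    by (rule N.distr_pair_fst)
  ultimately show ?thesis by (simp add: couplings_def)
qed

locale coupled_feature_maps =
  X: centered_feature_map \<mu> W u C + Y: centered_feature_map \<nu> Z v D
  for \<mu> :: "'a measure" and W :: "'w measure" and u C
    and \<nu> :: "'b measure" and Z :: "'z measure" and v D +
  fixes \<gamma> :: "('a \<times> 'b) measure"
  assumes coupling: "\<gamma> \<in> couplings \<mu> \<nu>"
begin

lemmas coupling_facts = couplingsD[OF X.M.prob_space_axioms coupling]

lemmas [measurable] = coupling_facts(4,5)

sublocale G: prob_space \<gamma> by (rule coupling_facts)
sublocale WZ: pair_prob_space W Z ..
sublocale GG: pair_prob_space \<gamma> \<gamma> ..

text \<open>
  The tensor product \<open>u x \<otimes> v y \<in> L\<^sup>2(W \<otimes> Z)\<close>; its mean under \<open>\<gamma>\<close> is the cross-covariance of the two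
  maps, written as a function instead of a Hilbert--Schmidt operator.
\<close>

definition feature :: "'a \<times> 'b \<Rightarrow> 'w \<times> 'z \<Rightarrow> real" where
  "feature = (\<lambda>(x, y) (\<xi>, \<zeta>). u x \<xi> * v y \<zeta>)"

definition cross_moment :: "'w \<times> 'z \<Rightarrow> real" where
  "cross_moment w = (\<integral>p. feature p w \<partial>\<gamma>)"

lemma measurable_feature [measurable]: "case_prod feature \<in> borel_measurable (\<gamma> \<Otimes>\<^sub>M (W \<Otimes>\<^sub>M Z))"
  unfolding feature_def split_beta by measurable

lemma feature_bounded: "\<bar>feature p w\<bar> \<le> C * D"
  by (auto simp: feature_def split_beta abs_mult intro!: mult_mono X.bounded Y.bounded X.C_nonneg)

lemma measurable_cross_moment [measurable]: "cross_moment \<in> borel_measurable (W \<Otimes>\<^sub>M Z)"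
  unfolding cross_moment_def by measurable

lemma cross_moment_bounded: "\<bar>cross_moment w\<bar> \<le> C * D"
  unfolding cross_moment_def
  by (rule G.abs_integral_bounded) (auto intro: feature_bounded mult_nonneg_nonneg X.C_nonneg Y.C_nonneg)

lemma gram_feature:
  assumes "p \<in> space \<gamma>" "p' \<in> space \<gamma>"
  shows "(\<integral>w. feature p w * feature p' w \<partial>(W \<Otimes>\<^sub>M Z))
    = X.gram (fst p) (fst p') * Y.gram (snd p) (snd p')"
proof -
  have p: "fst p \<in> space \<mu>" "fst p' \<in> space \<mu>" "snd p \<in> space \<nu>" "snd p' \<in> space \<nu>"
    using assms by (auto simp: coupling_facts)
  have "(\<integral>w. feature p w * feature p' w \<partial>(W \<Otimes>\<^sub>M Z))
     = (\<integral>w. (u (fst p) (fst w) * u (fst p') (fst w)) * (v (snd p) (snd w) * v (snd p') (snd w)) \<partial>(W \<Otimes>\<^sub>M Z))"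
    by (simp add: feature_def split_beta mult_ac)
  also have "\<dots> = X.gram (fst p) (fst p') * Y.gram (snd p) (snd p')"
  proof (subst WZ.integral_fst'[symmetric])
    show "integrable (W \<Otimes>\<^sub>M Z) (\<lambda>w. (u (fst p) (fst w) * u (fst p') (fst w)) * (v (snd p) (snd w) * v (snd p') (snd w)))"
    proof (rule WZ.P.integrable_bounded)
      show "\<bar>(u (fst p) (fst w) * u (fst p') (fst w)) * (v (snd p) (snd w) * v (snd p') (snd w))\<bar> \<le> (C * C) * (D * D)" for w
        unfolding abs_mult[of "_ * _" "_ * _"]
        by (intro mult_mono X.bounded_prod Y.bounded_prod mult_nonneg_nonneg X.C_nonneg) auto
    qed (use p in measurable)
  qed (simp add: X.gram_def Y.gram_def)
  finally show ?thesis .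
qed

text \<open>
  Write \<open>d(x,x') = A(x) + A(x') - 2 k(x,x')\<close> and \<open>e(y,y') = B(y) + B(y') - 2 l(y,y')\<close> with the Gram kernels
  \<open>k\<close>, \<open>l\<close> and their diagonals \<open>A\<close>, \<open>B\<close>. In \<open>(d - e)\<^sup>2\<close> the squares \<open>d\<^sup>2\<close> and \<open>e\<^sup>2\<close> only see the marginals.
  Of the nine terms of \<open>d e\<close>, the four that contain exactly one of \<open>k\<close>, \<open>l\<close> vanish by centring; \<open>A B'\<close> and
  \<open>A' B\<close> give the product of the means of \<open>A\<close> and \<open>B\<close>, that is a quarter of the product of the mean
  distances; \<open>A B\<close> and \<open>A' B'\<close> give a term linear in \<open>\<gamma>\<close>; and \<open>4 k l\<close> gives four times the squared norm of
  the cross moment. Hence the objective is concave in \<open>\<gamma>\<close>.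
\<close>

lemma integral_squared_difference:
  assumes d: "\<And>x x'. x \<in> space \<mu> \<Longrightarrow> x' \<in> space \<mu> \<Longrightarrow> d x x' = (\<integral>\<xi>. (u x \<xi> - u x' \<xi>)\<^sup>2 \<partial>W)"
    and e: "\<And>y y'. y \<in> space \<nu> \<Longrightarrow> y' \<in> space \<nu> \<Longrightarrow> e y y' = (\<integral>\<zeta>. (v y \<zeta> - v y' \<zeta>)\<^sup>2 \<partial>Z)"
  shows "(\<integral>(x, y). (\<integral>(x', y'). (d x x' - e y y')\<^sup>2 \<partial>\<gamma>) \<partial>\<gamma>) =
    (\<integral>x. (\<integral>x'. (d x x')\<^sup>2 \<partial>\<mu>) \<partial>\<mu>) + (\<integral>y. (\<integral>y'. (e y y')\<^sup>2 \<partial>\<nu>) \<partial>\<nu>)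
    - (\<integral>x. (\<integral>x'. d x x' \<partial>\<mu>) \<partial>\<mu>) * (\<integral>y. (\<integral>y'. e y y' \<partial>\<nu>) \<partial>\<nu>)
    - 4 * (\<integral>(x, y). X.gram x x * Y.gram y y \<partial>\<gamma>) - 8 * (\<integral>w. (cross_moment w)\<^sup>2 \<partial>(W \<Otimes>\<^sub>M Z))"
proof -
  let ?A = "\<lambda>x. X.gram x x" and ?B = "\<lambda>y. Y.gram y y"
  define d' where "d' x x' = ?A x + ?A x' - 2 * X.gram x x'" for x x'
  define e' where "e' y y' = ?B y + ?B y' - 2 * Y.gram y y'" for y y'
  have d': "d x x' = d' x x'" if "x \<in> space \<mu>" "x' \<in> space \<mu>" for x x'
    using d[OF that] X.squared_distance_gram[OF that] by (simp add: d'_def)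
  have e': "e y y' = e' y y'" if "y \<in> space \<nu>" "y' \<in> space \<nu>" for y y'
    using e[OF that] Y.squared_distance_gram[OF that] by (simp add: e'_def)
  have [measurable]: "case_prod d' \<in> borel_measurable (\<mu> \<Otimes>\<^sub>M \<mu>)" "case_prod e' \<in> borel_measurable (\<nu> \<Otimes>\<^sub>M \<nu>)"
    unfolding d'_def e'_def by measurable
  \<comment> \<open>All integrands are bounded and measurable on the square of the coupling; on this class \<open>BM\<close>,
    which is closed under sums, products and exchange of the two arguments, the double integral \<open>J\<close>
    is additive.\<close>
  define J :: "('a \<times> 'b \<Rightarrow> 'a \<times> 'b \<Rightarrow> real) \<Rightarrow> real" where "J f = (\<integral>p. (\<integral>p'. f p p' \<partial>\<gamma>) \<partial>\<gamma>)" for f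
  define BM where "BM = {f. case_prod f \<in> borel_measurable (\<gamma> \<Otimes>\<^sub>M \<gamma>) \<and> (\<exists>c. \<forall>p p'. \<bar>f p p'\<bar> \<le> (c::real))}"
  have int: "integrable (\<gamma> \<Otimes>\<^sub>M \<gamma>) (case_prod f)" if "f \<in> BM" for f
    using that by (auto simp: BM_def intro!: GG.P.integrable_bounded)
  have J: "J f = integral\<^sup>L (\<gamma> \<Otimes>\<^sub>M \<gamma>) (case_prod f)" if "f \<in> BM" for f
    using GG.integral_fst[OF int[OF that]] by (simp add: J_def)
  have BM_add: "(\<lambda>p p'. f p p' + g p p') \<in> BM" and BM_mult: "(\<lambda>p p'. f p p' * g p p') \<in> BM"
    if fg: "f \<in> BM" "g \<in> BM" for f g
  proof -
    obtain a b where ab: "\<And>p p'. \<bar>f p p'\<bar> \<le> a" "\<And>p p'. \<bar>g p p'\<bar> \<le> b"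
      using fg by (auto simp: BM_def)
    have "\<bar>f p p' + g p p'\<bar> \<le> a + b" for p p'
      by (rule order_trans[OF abs_triangle_ineq add_mono[OF ab]])
    moreover have "\<bar>f p p' * g p p'\<bar> \<le> a * b" for p p'
      unfolding abs_mult by (intro mult_mono ab abs_ge_zero order_trans[OF abs_ge_zero ab(1)])
    ultimately show "(\<lambda>p p'. f p p' + g p p') \<in> BM" "(\<lambda>p p'. f p p' * g p p') \<in> BM"
      using fg by (auto simp: BM_def split_beta)
  qed
  have BM_const: "(\<lambda>p p'. c) \<in> BM" for c by (auto simp: BM_def)
  have BM_swap: "(\<lambda>p p'. f p' p) \<in> BM" if f: "f \<in> BM" for f
  proof -
    obtain c where c: "\<And>p p'. \<bar>f p p'\<bar> \<le> c" using f unfolding BM_def by blast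
    have "\<exists>c. \<forall>p p'. \<bar>f p' p\<bar> \<le> c" using c by (intro exI[of _ c]) blast
    then show ?thesis
      using f measurable_compose[OF measurable_pair_swap', of "case_prod f" \<gamma> \<gamma> borel]
      unfolding BM_def by (simp add: split_beta')
  qed
  have J_add: "J (\<lambda>p p'. f p p' + g p p') = J f + J g" if "f \<in> BM" "g \<in> BM" for f g
    using int that by (simp add: J BM_add split_beta')
  have J_cmult: "J (\<lambda>p p'. c * f p p') = c * J f" for c f
    by (simp add: J_def)
  have J_swap: "J (\<lambda>p p'. f p' p) = J f" if "f \<in> BM" for f
    using GG.Fubini_integral[OF int[OF that]] by (simp add: J_def)
  have BM: "(\<lambda>p p'. ?A (fst p)) \<in> BM" "(\<lambda>p p'. ?B (snd p)) \<in> BM"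
    "(\<lambda>p p'. X.gram (fst p) (fst p')) \<in> BM" "(\<lambda>p p'. Y.gram (snd p) (snd p')) \<in> BM"
    using X.gram_bounded Y.gram_bounded unfolding BM_def split_beta by (auto intro!: exI)
  note BM = BM BM_swap[OF BM(1)] BM_swap[OF BM(2)]
  let ?AB = "\<integral>p. ?A (fst p) * ?B (snd p) \<partial>\<gamma>"
  let ?a = "\<integral>x. ?A x \<partial>\<mu>" and ?b = "\<integral>y. ?B y \<partial>\<nu>"
  have intA: "(\<integral>p. ?A (fst p) \<partial>\<gamma>) = ?a" and intB: "(\<integral>p. ?B (snd p) \<partial>\<gamma>) = ?b"
    by (rule integral_coupling_fst[OF X.M.prob_space_axioms coupling] integral_coupling_snd[OF X.M.prob_space_axioms coupling]; measurable)+
  have cX: "(\<integral>p'. X.gram (fst p) (fst p') \<partial>\<gamma>) = 0" if "p \<in> space \<gamma>" for p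
    using that X.gram_centered[of "fst p"] integral_coupling_fst[OF X.M.prob_space_axioms coupling, of "X.gram (fst p)"]
    by (auto simp: coupling_facts)
  have cY: "(\<integral>p'. Y.gram (snd p) (snd p') \<partial>\<gamma>) = 0" if "p \<in> space \<gamma>" for p
    using that Y.gram_centered[of "snd p"] integral_coupling_snd[OF X.M.prob_space_axioms coupling, of "Y.gram (snd p)"]
    by (auto simp: coupling_facts)
  have zX: "J (\<lambda>p p'. f p * X.gram (fst p) (fst p')) = 0" and zY: "J (\<lambda>p p'. f p * Y.gram (snd p) (snd p')) = 0" for f
    using cX cY by (auto simp: J_def intro!: integral_eq_zero_AE)
  note J1 = zX[of "\<lambda>_. 1", unfolded mult_1] zY[of "\<lambda>_. 1", unfolded mult_1] zX[of "\<lambda>p. ?B (snd p)"] zY[of "\<lambda>p. ?A (fst p)"]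
  have J2: "J (\<lambda>p p'. ?B (snd p') * X.gram (fst p) (fst p')) = 0"
    using J_swap[of "\<lambda>p p'. ?B (snd p) * X.gram (fst p) (fst p')"] J1 BM by (simp add: X.gram_commute BM_mult)
  have J3: "J (\<lambda>p p'. ?A (fst p') * Y.gram (snd p) (snd p')) = 0"
    using J_swap[of "\<lambda>p p'. ?A (fst p) * Y.gram (snd p) (snd p')"] J1 BM by (simp add: Y.gram_commute BM_mult)
  have J4: "J (\<lambda>p p'. ?A (fst p)) = ?a" "J (\<lambda>p p'. ?B (snd p)) = ?b"
    "J (\<lambda>p p'. ?A (fst p')) = ?a" "J (\<lambda>p p'. ?B (snd p')) = ?b"
    "J (\<lambda>p p'. ?A (fst p) * ?B (snd p)) = ?AB" "J (\<lambda>p p'. ?A (fst p') * ?B (snd p')) = ?AB"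
    "J (\<lambda>p p'. ?A (fst p) * ?B (snd p')) = ?a * ?b" "J (\<lambda>p p'. ?B (snd p) * ?A (fst p')) = ?a * ?b"
    by (simp_all add: J_def intA intB G.prob_space)
  have "J (\<lambda>p p'. X.gram (fst p) (fst p') * Y.gram (snd p) (snd p')) =
    (\<integral>p. (\<integral>p'. (\<integral>w. feature p w * feature p' w \<partial>(W \<Otimes>\<^sub>M Z)) \<partial>\<gamma>) \<partial>\<gamma>)"
    unfolding J_def by (intro Bochner_Integration.integral_cong refl) (simp add: gram_feature)
  then have J5: "J (\<lambda>p p'. X.gram (fst p) (fst p') * Y.gram (snd p) (snd p')) =
      (\<integral>w. (cross_moment w)\<^sup>2 \<partial>(W \<Otimes>\<^sub>M Z))"
    using integral_gram_kernel[OF G.prob_space_axioms WZ.prob_space_axioms measurable_feature feature_bounded]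
    by (simp add: cross_moment_def)
  define dd where "dd p p' = d' (fst p) (fst p')" for p p' :: "'a \<times> 'b"
  define ee where "ee p p' = e' (snd p) (snd p')" for p p' :: "'a \<times> 'b"
  have dd: "dd = (\<lambda>p p'. ?A (fst p) + (?A (fst p') + (-2) * X.gram (fst p) (fst p')))"
    and ee: "ee = (\<lambda>p p'. ?B (snd p) + (?B (snd p') + (-2) * Y.gram (snd p) (snd p')))"
    by (simp_all add: dd_def ee_def d'_def e'_def fun_eq_iff)
  note BM_rules = BM BM_add BM_mult BM_const
  have BMde: "dd \<in> BM" "ee \<in> BM" unfolding dd ee by (intro BM_rules)+
  have "J dd = ?a + (?a + (-2) * 0)" "J ee = ?b + (?b + (-2) * 0)"
    unfolding dd ee by (simp_all only: J_add J_cmult BM_rules J4 J1)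
  then have Jd: "J dd = 2 * ?a" "J ee = 2 * ?b" by simp_all
  \<comment> \<open>The product is multiplied out with every term in the form that \<open>J_add\<close> and \<open>J_cmult\<close> accept.\<close>
  have de: "(\<lambda>p p'. dd p p' * ee p p') = (\<lambda>p p'. ?A (fst p) * ?B (snd p) + (?A (fst p') * ?B (snd p')
      + (?A (fst p) * ?B (snd p') + (?B (snd p) * ?A (fst p')
      + ((-2) * (?A (fst p) * Y.gram (snd p) (snd p')) + ((-2) * (?A (fst p') * Y.gram (snd p) (snd p'))
      + ((-2) * (?B (snd p) * X.gram (fst p) (fst p')) + ((-2) * (?B (snd p') * X.gram (fst p) (fst p'))
      + 4 * (X.gram (fst p) (fst p') * Y.gram (snd p) (snd p'))))))))))"
    by (simp add: dd ee fun_eq_iff algebra_simps)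
  have "J (\<lambda>p p'. dd p p' * ee p p') = ?AB + (?AB + (?a * ?b + (?a * ?b + ((-2) * 0 + ((-2) * 0
      + ((-2) * 0 + ((-2) * 0 + 4 * (\<integral>w. (cross_moment w)\<^sup>2 \<partial>(W \<Otimes>\<^sub>M Z)))))))))"
    unfolding de by (simp only: J_add J_cmult BM_rules J4 J1 J2 J3 J5)
  then have Jde: "J (\<lambda>p p'. dd p p' * ee p p')
      = 2 * ?AB + 2 * (?a * ?b) + 4 * (\<integral>w. (cross_moment w)\<^sup>2 \<partial>(W \<Otimes>\<^sub>M Z))"
    by simp
  have "(\<integral>(x, y). (\<integral>(x', y'). (d x x' - e y y')\<^sup>2 \<partial>\<gamma>) \<partial>\<gamma>) = J (\<lambda>p p'. (dd p p' - ee p p')\<^sup>2)"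
    unfolding J_def dd_def ee_def split_beta
    by (intro Bochner_Integration.integral_cong refl) (simp add: coupling_facts mem_Times_iff d' e')
  also have "(\<lambda>p p'. (dd p p' - ee p p')\<^sup>2)
      = (\<lambda>p p'. dd p p' * dd p p' + (ee p p' * ee p p' + (-2) * (dd p p' * ee p p')))"
    by (simp add: fun_eq_iff power2_eq_square algebra_simps)
  also have "J \<dots> = J (\<lambda>p p'. dd p p' * dd p p') + (J (\<lambda>p p'. ee p p' * ee p p') + (-2) * J (\<lambda>p p'. dd p p' * ee p p'))"
    by (simp only: J_add J_cmult BM_rules BMde)
  finally have main: "(\<integral>(x, y). (\<integral>(x', y'). (d x x' - e y y')\<^sup>2 \<partial>\<gamma>) \<partial>\<gamma>) =
     J (\<lambda>p p'. dd p p' * dd p p') + (J (\<lambda>p p'. ee p p' * ee p p') + (-2) * J (\<lambda>p p'. dd p p' * ee p p'))" .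
  have JX: "J (\<lambda>p p'. f (d' (fst p) (fst p'))) = (\<integral>x. (\<integral>x'. f (d x x') \<partial>\<mu>) \<partial>\<mu>)"
    if [measurable]: "f \<in> borel_measurable borel" for f :: "real \<Rightarrow> real"
  proof -
    have "J (\<lambda>p p'. f (d' (fst p) (fst p'))) = (\<integral>p. (\<integral>x'. f (d' (fst p) x') \<partial>\<mu>) \<partial>\<gamma>)"
      unfolding J_def by (intro Bochner_Integration.integral_cong refl
        integral_coupling_fst[OF X.M.prob_space_axioms coupling]) (auto simp: coupling_facts)
    also have "\<dots> = (\<integral>x. (\<integral>x'. f (d' x x') \<partial>\<mu>) \<partial>\<mu>)"
      by (rule integral_coupling_fst[OF X.M.prob_space_axioms coupling]) measurable
    also have "\<dots> = (\<integral>x. (\<integral>x'. f (d x x') \<partial>\<mu>) \<partial>\<mu>)"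
      by (intro Bochner_Integration.integral_cong refl) (simp add: d')
    finally show ?thesis .
  qed
  have JY: "J (\<lambda>p p'. f (e' (snd p) (snd p'))) = (\<integral>y. (\<integral>y'. f (e y y') \<partial>\<nu>) \<partial>\<nu>)"
    if [measurable]: "f \<in> borel_measurable borel" for f :: "real \<Rightarrow> real"
  proof -
    have "J (\<lambda>p p'. f (e' (snd p) (snd p'))) = (\<integral>p. (\<integral>y'. f (e' (snd p) y') \<partial>\<nu>) \<partial>\<gamma>)"
      unfolding J_def by (intro Bochner_Integration.integral_cong refl
        integral_coupling_snd[OF X.M.prob_space_axioms coupling]) (auto simp: coupling_facts)
    also have "\<dots> = (\<integral>y. (\<integral>y'. f (e' y y') \<partial>\<nu>) \<partial>\<nu>)"
      by (rule integral_coupling_snd[OF X.M.prob_space_axioms coupling]) measurable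
    also have "\<dots> = (\<integral>y. (\<integral>y'. f (e y y') \<partial>\<nu>) \<partial>\<nu>)"
      by (intro Bochner_Integration.integral_cong refl) (simp add: e')
    finally show ?thesis .
  qed
  have Id: "(\<integral>x. (\<integral>x'. d x x' \<partial>\<mu>) \<partial>\<mu>) = 2 * ?a" "(\<integral>y. (\<integral>y'. e y y' \<partial>\<nu>) \<partial>\<nu>) = 2 * ?b"
    using Jd JX[of "\<lambda>r. r"] JY[of "\<lambda>r. r"] by (simp_all add: dd_def[abs_def] ee_def[abs_def])
  have Jsq: "J (\<lambda>p p'. dd p p' * dd p p') = (\<integral>x. (\<integral>x'. (d x x')\<^sup>2 \<partial>\<mu>) \<partial>\<mu>)"
    "J (\<lambda>p p'. ee p p' * ee p p') = (\<integral>y. (\<integral>y'. (e y y')\<^sup>2 \<partial>\<nu>) \<partial>\<nu>)"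
    using JX[of "\<lambda>r. r\<^sup>2"] JY[of "\<lambda>r. r\<^sup>2"] by (simp_all add: dd_def ee_def power2_eq_square)
  show ?thesis
    unfolding main Jde Jsq Id by (simp add: split_beta')
qed

text \<open>
  Averaging over \<open>\<gamma>\<close> commutes with pairing with \<open>a\<close>, so the second part of the cost sees \<open>\<gamma>\<close> only through the
  cross moment.
\<close>

lemma integral_dual_cost:
  assumes a: "a \<in> L2_fun (W \<Otimes>\<^sub>M Z)"
  shows "(\<integral>(x, y). - 4 * X.gram x x * Y.gram y y - 2 * (\<integral>w. a w * feature (x, y) w \<partial>(W \<Otimes>\<^sub>M Z)) \<partial>\<gamma>)
    = - 4 * (\<integral>(x, y). X.gram x x * Y.gram y y \<partial>\<gamma>) - 2 * (\<integral>w. a w * cross_moment w \<partial>(W \<Otimes>\<^sub>M Z))"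
proof -
  have [measurable]: "a \<in> borel_measurable (W \<Otimes>\<^sub>M Z)" using a by (simp add: L2_fun_def)
  have a1: "integrable (W \<Otimes>\<^sub>M Z) a"
    by (rule WZ.P.square_integrable_imp_integrable) (use a in \<open>simp_all add: L2_fun_def\<close>)
  have gram: "integrable \<gamma> (\<lambda>p. X.gram (fst p) (fst p) * Y.gram (snd p) (snd p))"
  proof (rule G.integrable_bounded)
    show "\<bar>X.gram (fst p) (fst p) * Y.gram (snd p) (snd p)\<bar> \<le> (C * C) * (D * D)" for p
      unfolding abs_mult by (intro mult_mono X.gram_bounded Y.gram_bounded mult_nonneg_nonneg X.C_nonneg) auto
  qed measurable
  have lin: "integrable \<gamma> (\<lambda>p. \<integral>w. a w * feature p w \<partial>(W \<Otimes>\<^sub>M Z))"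
  proof (rule G.integrable_bounded)
    fix p assume "p \<in> space \<gamma>"
    have *: "\<bar>a w * feature p w\<bar> \<le> (C * D) * \<bar>a w\<bar>" for w
      using mult_left_mono[OF feature_bounded[of p w], of "\<bar>a w\<bar>"] by (simp add: abs_mult mult.commute)
    have fm: "feature p \<in> borel_measurable (W \<Otimes>\<^sub>M Z)"
      using measurable_compose[OF measurable_Pair1'[OF \<open>p \<in> space \<gamma>\<close>] measurable_feature] by simp
    have "integrable (W \<Otimes>\<^sub>M Z) (\<lambda>w. a w * feature p w)"
    proof (rule Bochner_Integration.integrable_bound)
      show "integrable (W \<Otimes>\<^sub>M Z) (\<lambda>w. (C * D) * \<bar>a w\<bar>)" using a1 by simp
      show "(\<lambda>w. a w * feature p w) \<in> borel_measurable (W \<Otimes>\<^sub>M Z)" using fm by measurable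
      show "AE w in W \<Otimes>\<^sub>M Z. norm (a w * feature p w) \<le> norm ((C * D) * \<bar>a w\<bar>)"
        unfolding real_norm_def by (intro AE_I2 order_trans[OF * abs_ge_self])
    qed
    then show "\<bar>\<integral>w. a w * feature p w \<partial>(W \<Otimes>\<^sub>M Z)\<bar> \<le> (\<integral>w. (C * D) * \<bar>a w\<bar> \<partial>(W \<Otimes>\<^sub>M Z))"
      using * a1 by (intro order_trans[OF integral_abs_bound integral_mono]) auto
  qed measurable
  have "(\<integral>p. (\<integral>w. a w * feature p w \<partial>(W \<Otimes>\<^sub>M Z)) \<partial>\<gamma>) = (\<integral>w. a w * cross_moment w \<partial>(W \<Otimes>\<^sub>M Z))"
    unfolding cross_moment_def
    by (rule integral_mult_mixture[OF G.prob_space_axioms WZ.prob_space_axioms measurable_feature feature_bounded a1])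
  then show ?thesis
    using gram lin by (simp add: split_beta' mult.assoc)
qed

lemma cross_moment_L2: "cross_moment \<in> L2_fun (W \<Otimes>\<^sub>M Z)"
  unfolding L2_fun_def
proof (intro CollectI conjI)
  show "integrable (W \<Otimes>\<^sub>M Z) (\<lambda>w. (cross_moment w)\<^sup>2)"
    by (rule WZ.P.integrable_bounded[OF _ abs_square_bounded[OF cross_moment_bounded]]) measurable
qed measurable

end

section \<open>The conjugate of the square\<close>

lemma (in finite_measure) L2_fun_integrable_mult:
  assumes "f \<in> L2_fun M" "g \<in> L2_fun M"
  shows "integrable M (\<lambda>w. f w * g w)"
proof (rule Bochner_Integration.integrable_bound)
  show "integrable M (\<lambda>w. (f w)\<^sup>2 + (g w)\<^sup>2)" using assms by (auto simp: L2_fun_def)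
  show "(\<lambda>w. f w * g w) \<in> borel_measurable M" using assms by (auto simp: L2_fun_def)
  have "norm (f w * g w) \<le> norm ((f w)\<^sup>2 + (g w)\<^sup>2)" for w
    using sum_squares_bound[of "\<bar>f w\<bar>" "\<bar>g w\<bar>"] mult_nonneg_nonneg[of "\<bar>f w\<bar>" "\<bar>g w\<bar>"]
    by (simp add: abs_mult del: mult_nonneg_nonneg)
  then show "AE w in M. norm (f w * g w) \<le> norm ((f w)\<^sup>2 + (g w)\<^sup>2)" by simp
qed

lemma L2_norm_square: "(L2_norm M f)\<^sup>2 = (\<integral>w. (f w)\<^sup>2 \<partial>M)"
  by (simp add: L2_norm_def)

text \<open>
  Completing the square: \<open>m \<mapsto> - 8 \<parallel>m\<parallel>\<^sup>2\<close> is the infimum over \<open>a\<close> of the affine functions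
  \<open>m \<mapsto> \<parallel>a\<parallel>\<^sup>2 / 8 - 2 \<langle>a, m\<rangle>\<close>, attained at \<open>a = 8 m\<close>.
\<close>

lemma (in finite_measure) L2_conjugate_square:
  assumes a: "a \<in> L2_fun M" and m: "m \<in> L2_fun M"
  shows "1 / 8 * (L2_norm M a)\<^sup>2 - 2 * (\<integral>w. a w * m w \<partial>M)
    = 1 / 8 * (\<integral>w. (a w - 8 * m w)\<^sup>2 \<partial>M) - 8 * (\<integral>w. (m w)\<^sup>2 \<partial>M)"
proof -
  have "(\<integral>w. (a w - 8 * m w)\<^sup>2 \<partial>M) = (\<integral>w. (a w)\<^sup>2 + 64 * (m w)\<^sup>2 - 16 * (a w * m w) \<partial>M)"
    by (simp add: power2_eq_square algebra_simps)
  also have "\<dots> = (\<integral>w. (a w)\<^sup>2 \<partial>M) + 64 * (\<integral>w. (m w)\<^sup>2 \<partial>M) - 16 * (\<integral>w. a w * m w \<partial>M)"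
    using a m L2_fun_integrable_mult[OF a m] by (simp add: L2_fun_def)
  finally show ?thesis by (simp add: L2_norm_square field_simps)
qed

section \<open>Bochner integrals against differences of probability measures\<close>

lemma (in prob_space) square_expectation_le:
  fixes f :: "'a \<Rightarrow> real"
  assumes [measurable]: "f \<in> borel_measurable M" and bnd: "\<And>x. \<bar>f x\<bar> \<le> C"
  shows "(\<integral>x. f x \<partial>M)\<^sup>2 \<le> (\<integral>x. (f x)\<^sup>2 \<partial>M)"
proof -
  have "integrable M f" by (rule integrable_bounded[of _ C]) (auto intro: bnd)
  moreover have "integrable M (\<lambda>x. (f x)\<^sup>2)"
    by (rule integrable_bounded[OF _ abs_square_bounded[OF bnd]]) measurable
  ultimately show ?thesis using variance_positive[of f] by (simp add: variance_eq)
qed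

text \<open>
  Jensen's inequality for the squared norm of \<open>L\<^sup>2(W)\<close>, applied at each \<open>w\<close> and then integrated.
\<close>

lemma integral_square_mixture_le:
  fixes h :: "'p \<Rightarrow> 'w \<Rightarrow> real"
  assumes "prob_space P" "prob_space W"
    and [measurable]: "case_prod h \<in> borel_measurable (P \<Otimes>\<^sub>M W)" and bnd: "\<And>p w. \<bar>h p w\<bar> \<le> C"
  shows "(\<integral>w. (\<integral>p. h p w \<partial>P)\<^sup>2 \<partial>W) \<le> (\<integral>p. (\<integral>w. (h p w)\<^sup>2 \<partial>W) \<partial>P)"
proof -
  interpret P: prob_space P by fact
  interpret W: prob_space W by fact
  interpret PW: pair_prob_space P W ..
  have C: "0 \<le> C" using order_trans[OF abs_ge_zero bnd] .
  note sq = abs_square_bounded[OF bnd]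
  have m: "\<bar>\<integral>p. h p w \<partial>P\<bar> \<le> C" for w by (rule P.abs_integral_bounded) (auto intro: bnd C)
  note msq = abs_square_bounded[OF m]
  have "(\<integral>w. (\<integral>p. h p w \<partial>P)\<^sup>2 \<partial>W) \<le> (\<integral>w. (\<integral>p. (h p w)\<^sup>2 \<partial>P) \<partial>W)"
  proof (rule integral_mono)
    show "integrable W (\<lambda>w. (\<integral>p. h p w \<partial>P)\<^sup>2)"
      by (rule W.integrable_bounded[OF _ msq]) measurable
    show "integrable W (\<lambda>w. \<integral>p. (h p w)\<^sup>2 \<partial>P)"
      by (rule W.integrable_bounded[OF _ P.abs_integral_bounded[OF sq]]) auto
    fix w assume "w \<in> space W"
    then have "(\<lambda>p. h p w) \<in> borel_measurable P" by measurable
    then show "(\<integral>p. h p w \<partial>P)\<^sup>2 \<le> (\<integral>p. (h p w)\<^sup>2 \<partial>P)"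
      using bnd by (rule P.square_expectation_le)
  qed
  also have "\<dots> = (\<integral>p. (\<integral>w. (h p w)\<^sup>2 \<partial>W) \<partial>P)"
    by (rule PW.Fubini_integral, rule PW.P.integrable_bounded[of _ "C\<^sup>2"]) (use sq in auto)
  finally show ?thesis .
qed

text \<open>
  This turns the sums in the definition of the Bochner integral into integrals, so that they can be
  compared with the pointwise integral of the limit.
\<close>

lemma integral_simple_family:
  fixes s :: "'p \<Rightarrow> 'w \<Rightarrow> real"
  assumes "finite_measure P" and s: "simple_function P s"
  shows "(\<integral>p. s p w \<partial>P) = (\<Sum>f\<in>s ` space P. measure P {p \<in> space P. s p = f} * f w)"
proof -
  interpret finite_measure P by fact
  have S: "finite (s ` space P)" "{p \<in> space P. s p = f} \<in> sets P" for f
  proof -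
    show "finite (s ` space P)" using s by (rule simple_functionD)
    have "s -` {f} \<inter> space P \<in> sets P" using s by (rule simple_functionD)
    also have "s -` {f} \<inter> space P = {p \<in> space P. s p = f}" by auto
    finally show "{p \<in> space P. s p = f} \<in> sets P" .
  qed
  have "(\<integral>p. s p w \<partial>P) = (\<integral>p. (\<Sum>f\<in>s ` space P. f w * indicator {p \<in> space P. s p = f} p) \<partial>P)"
  proof (rule Bochner_Integration.integral_cong[OF refl])
    fix p assume p: "p \<in> space P"
    have "(\<Sum>f\<in>s ` space P. f w * indicator {p \<in> space P. s p = f} p) = (\<Sum>f\<in>s ` space P. if f = s p then f w else 0)"
      using p by (intro sum.cong) auto
    then show "s p w = (\<Sum>f\<in>s ` space P. f w * indicator {p \<in> space P. s p = f} p)"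
      using S(1) p by simp
  qed
  also have "\<dots> = (\<Sum>f\<in>s ` space P. f w * measure P {p \<in> space P. s p = f})"
    using S by (subst Bochner_Integration.integral_sum) (auto simp: emeasure_finite less_top[symmetric] Int_absorb2 sets.sets_into_space)
  finally show ?thesis by (simp add: mult.commute)
qed

lemma signed_measure_diff:
  assumes "finite_measure P" "finite_measure Q" "sets P = sets N" "sets Q = sets N"
  shows "signed_measure N (\<lambda>A. measure P A - measure Q A)"
proof -
  interpret P: finite_measure P by fact
  interpret Q: finite_measure Q by fact
  show ?thesis
    unfolding signed_measure_def
    using assms by (auto intro!: sums_diff P.finite_measure_UNION Q.finite_measure_UNION)
qed

lemma space_total_variation [simp]: "space (total_variation N \<eta>) = space N"
  and sets_total_variation [simp]: "sets (total_variation N \<eta>) = sets N"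
  by (simp_all add: total_variation_def space_measure_of_conv sets.space_closed)

text \<open>
  On a finite partition the two measures contribute at most their total masses, one each.
\<close>

lemma TV_norm_diff_le:
  assumes "prob_space P" "prob_space Q" and sets: "sets P = sets N" "sets Q = sets N"
  shows "TV_norm N (\<lambda>A. measure P A - measure Q A) \<le> 2"
proof -
  interpret P: prob_space P by fact
  interpret Q: prob_space Q by fact
  have sm: "signed_measure N (\<lambda>A. measure P A - measure Q A)"
    by (rule signed_measure_diff) (use sets in \<open>auto intro: P.finite_measure_axioms Q.finite_measure_axioms\<close>)
  have "(\<Sum>B\<in>R. ennreal \<bar>measure P B - measure Q B\<bar>) \<le> 2"
    if R: "finite R" "R \<subseteq> sets N" "disjoint R" for R
  proof -
    have dj: "disjoint_family_on (\<lambda>B. B) R" using R(3) by (auto simp: disjoint_family_on_def disjoint_def)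
    have "(\<Sum>B\<in>R. \<bar>measure P B - measure Q B\<bar>) \<le> (\<Sum>B\<in>R. measure P B + measure Q B)"
      by (intro sum_mono) (simp add: abs_le_iff)
    also have "\<dots> = measure P (\<Union>B\<in>R. B) + measure Q (\<Union>B\<in>R. B)"
      using R dj sets by (subst (1 2) measure_finite_Union[of R "\<lambda>B. B"]) (auto simp: sum.distrib)
    also have "\<dots> \<le> 2" using add_mono[OF P.prob_le_1 Q.prob_le_1, of "\<Union>B\<in>R. B" "\<Union>B\<in>R. B"] by simp
    finally have "ennreal (\<Sum>B\<in>R. \<bar>measure P B - measure Q B\<bar>) \<le> ennreal 2" by (rule ennreal_leI)
    then show ?thesis by (simp add: sum_ennreal)
  qed
  then show ?thesis
    unfolding TV_norm_def emeasure_total_variation[OF sm sets.top] by (intro SUP_least) auto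
qed

text \<open>
  If \<open>p \<mapsto> G p\<close> is Hoelder continuous with exponent \<open>1/2\<close> into \<open>L\<^sup>2(W)\<close>, its Bochner integral against
  \<open>P - Q\<close> exists and is the pointwise integral. The simple functions are \<open>G \<circ> q n\<close>, where the \<open>q n\<close> are simple
  and converge pointwise to the identity of the separable metric space \<open>K\<close>: Hoelder continuity
  bounds every error by a power of \<open>dist p (q n p)\<close>, and dominated convergence applies because \<open>K\<close> is bounded.
  The values of \<open>q n\<close> may lie outside \<open>K\<close>, which is why \<open>G\<close> has to live on the whole space, while
  \<open>F\<close> agrees with it on \<open>K\<close> only.
\<close>

lemma has_L2_bochner_integral_diff:
  fixes K :: "'p::{metric_space, second_countable_topology} set" and G :: "'p \<Rightarrow> 'w \<Rightarrow> real"
  assumes "prob_space W" "prob_space P" "prob_space Q"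
    and sets: "sets P = sets (restrict_space borel K)" "sets Q = sets (restrict_space borel K)"
    and K: "bounded K"
    and G[measurable]: "case_prod G \<in> borel_measurable (borel \<Otimes>\<^sub>M W)" and bnd: "\<And>p w. \<bar>G p w\<bar> \<le> C"
    and lip: "\<And>p q. (\<integral>w. (G p w - G q w)\<^sup>2 \<partial>W) \<le> L * dist p q"
    and F: "\<And>p. p \<in> K \<Longrightarrow> F p = G p"
  shows "has_L2_bochner_integral W (restrict_space borel K) (\<lambda>A. measure P A - measure Q A) F
    (\<lambda>w. (\<integral>p. G p w \<partial>P) - (\<integral>p. G p w \<partial>Q))"
proof -
  interpret W: prob_space W by fact
  interpret P: prob_space P by fact
  interpret Q: prob_space Q by fact
  let ?N = "restrict_space borel K" and ?\<eta> = "\<lambda>A. measure P A - measure Q A"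
  let ?TV = "total_variation ?N ?\<eta>"
  have space: "space P = K" "space Q = K" "space ?N = K"
    using sets_eq_imp_space_eq[OF sets(1)] sets_eq_imp_space_eq[OF sets(2)] by (auto simp: space_restrict_space)
  have borel: "(\<lambda>p. p) \<in> M \<rightarrow>\<^sub>M borel" if "sets M = sets ?N" for M
    using that by (simp add: measurable_cong_sets[OF that refl] measurable_restrict_space1)
  interpret TV: finite_measure ?TV
  proof
    show "emeasure ?TV (space ?TV) \<noteq> \<infinity>"
      using TV_norm_diff_le[OF assms(2,3) sets] by (auto simp: TV_norm_def top_unique)
  qed
  have C: "0 \<le> C" using order_trans[OF abs_ge_zero bnd] .
  obtain z B where B: "\<And>p. p \<in> K \<Longrightarrow> dist p z \<le> B"
    using K by (auto simp: bounded_def dist_commute)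
  obtain q where q: "\<And>n. simple_function ?N (q n)" "\<And>p. p \<in> K \<Longrightarrow> (\<lambda>n. q n p) \<longlonglongrightarrow> p"
    "\<And>n p. p \<in> K \<Longrightarrow> dist (q n p) z \<le> 2 * dist p z"
    using borel_measurable_implies_sequence_metric[OF borel[OF refl], of z] unfolding space by blast
  \<comment> \<open>The triangle inequality through \<open>z\<close>: \<open>B\<close> for \<open>p\<close> and \<open>2 * B\<close> for its approximant.\<close>
  have dist_le: "dist p (q n p) \<le> 3 * B" if "p \<in> K" for n p
    using dist_triangle2[of p "q n p" z] q(3)[OF that, of n] B[OF that] by simp
  have L: "0 \<le> L * dist p p'" for p p' :: 'p
  proof -
    have "0 \<le> (\<integral>w. (G p w - G p' w)\<^sup>2 \<partial>W)" by simp
    then show ?thesis using lip[of p p'] by (rule order_trans)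
  qed
  have L': "L * dist p (q n p) \<le> \<bar>L\<bar> * (3 * B)" if "p \<in> K" for n p
    using dist_le[OF that] by (intro mult_mono abs_ge_self) auto
  have qm: "q n \<in> M \<rightarrow>\<^sub>M borel" if "sets M = sets ?N" for n M
    using borel_measurable_simple_function[OF q(1)] measurable_cong_sets[OF that refl] by blast
  define s where "s n p = G (q n p)" for n p
  have s: "simple_function ?N (s n)" for n
    unfolding s_def[abs_def] using simple_function_compose1[OF q(1), of G] by simp
  have Gsec [measurable]: "G p \<in> borel_measurable W" for p
    using measurable_compose[OF measurable_Pair1' G] by simp
  have L2: "f \<in> L2_fun W" if [measurable]: "f \<in> borel_measurable W" and "\<And>w. \<bar>f w\<bar> \<le> c" for f c
    unfolding L2_fun_def by (auto intro: W.integrable_bounded[OF _ abs_square_bounded[OF that(2)]])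
  have norm_le: "L2_norm W (\<lambda>w. F p w - s n p w) \<le> sqrt (L * dist p (q n p))" if "p \<in> K" for n p
    using lip[of p "q n p"] by (simp add: L2_norm_def F[OF that] s_def)
  have dist_lim: "(\<lambda>n. L * dist p (q n p)) \<longlonglongrightarrow> 0" if "p \<in> K" for p
  proof -
    have "(\<lambda>n. L * dist p (q n p)) \<longlonglongrightarrow> L * dist p p" by (intro tendsto_intros q(2) that)
    then show ?thesis by simp
  qed
  have sqrt_lim: "(\<lambda>n. sqrt (L * dist p (q n p))) \<longlonglongrightarrow> 0" if "p \<in> K" for p
    using tendsto_real_sqrt[OF dist_lim[OF that]] by simp
  \<comment> \<open>The integrals against \<open>P\<close> and \<open>Q\<close> are approximated separately.\<close>
  have Pq: "(\<integral>w. ((\<integral>p. G p w \<partial>R) - (\<integral>p. s n p w \<partial>R))\<^sup>2 \<partial>W) \<le> (\<integral>p. L * dist p (q n p) \<partial>R)"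
    and lim: "(\<lambda>n. \<integral>p. L * dist p (q n p) \<partial>R) \<longlonglongrightarrow> 0"
    and meas: "(\<lambda>w. \<integral>p. G p w \<partial>R) \<in> borel_measurable W" "(\<lambda>w. \<integral>p. s n p w \<partial>R) \<in> borel_measurable W"
    and sum: "(\<integral>p. s n p w \<partial>R) = (\<Sum>f\<in>s n ` K. measure R {p \<in> K. s n p = f} * f w)"
    if R: "prob_space R" and Rs: "sets R = sets ?N" for R n w
  proof -
    interpret R: prob_space R by fact
    note [measurable] = qm[OF Rs] borel[OF Rs]
    have sp: "space R = K" using sets_eq_imp_space_eq[OF Rs] space by simp
    have Gm [measurable]: "case_prod G \<in> borel_measurable (R \<Otimes>\<^sub>M W)"
      using measurable_Pair_compose_split[OF G, of fst _ snd] by (simp add: split_beta' measurable_compose[OF measurable_fst borel[OF Rs]])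
    have sm [measurable]: "case_prod (s n) \<in> borel_measurable (R \<Otimes>\<^sub>M W)" for n
      unfolding s_def split_beta' by (rule measurable_Pair_compose_split[OF G]) measurable
    show "(\<lambda>w. \<integral>p. G p w \<partial>R) \<in> borel_measurable W" "(\<lambda>w. \<integral>p. s n p w \<partial>R) \<in> borel_measurable W" by measurable
    have Gi: "integrable R (\<lambda>p. G p w)" "integrable R (\<lambda>p. s n p w)" if "w \<in> space W" for w n
      using that by (auto intro!: R.integrable_bounded[of _ C] bnd simp: s_def)
    have b2: "\<bar>G p w - s n p w\<bar> \<le> C + C" for p w
      unfolding s_def by (rule order_trans[OF abs_triangle_ineq4 add_mono[OF bnd bnd]])
    have "(\<integral>w. ((\<integral>p. G p w \<partial>R) - (\<integral>p. s n p w \<partial>R))\<^sup>2 \<partial>W) = (\<integral>w. (\<integral>p. G p w - s n p w \<partial>R)\<^sup>2 \<partial>W)"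
      by (intro Bochner_Integration.integral_cong refl) (simp add: Gi)
    also have "\<dots> \<le> (\<integral>p. (\<integral>w. (G p w - s n p w)\<^sup>2 \<partial>W) \<partial>R)"
      by (rule integral_square_mixture_le[OF R assms(1) _ b2]) (use Gm sm[of n] in measurable)
    also have "\<dots> \<le> (\<integral>p. L * dist p (q n p) \<partial>R)"
    proof (rule integral_mono')
      show "integrable R (\<lambda>p. L * dist p (q n p))"
        by (rule R.integrable_bounded[of _ "\<bar>L\<bar> * (3 * B)"]) (use L' L sp in \<open>auto simp: abs_of_nonneg\<close>)
    qed (use lip L in \<open>auto simp: s_def\<close>)
    finally show "(\<integral>w. ((\<integral>p. G p w \<partial>R) - (\<integral>p. s n p w \<partial>R))\<^sup>2 \<partial>W) \<le> (\<integral>p. L * dist p (q n p) \<partial>R)" .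
    have "(\<lambda>n. \<integral>p. L * dist p (q n p) \<partial>R) \<longlonglongrightarrow> (\<integral>p. 0 \<partial>R)"
      by (rule integral_dominated_convergence[where w = "\<lambda>_. \<bar>L\<bar> * (3 * B)"])
         (use dist_lim L' L sp in \<open>auto simp: abs_of_nonneg\<close>)
    then show "(\<lambda>n. \<integral>p. L * dist p (q n p) \<partial>R) \<longlonglongrightarrow> 0" by simp
    have "simple_function R (s n)" using s space sp by (simp add: simple_function_cong_algebra[OF Rs[symmetric]])
    from integral_simple_family[OF R.finite_measure_axioms this]
    show "(\<integral>p. s n p w \<partial>R) = (\<Sum>f\<in>s n ` K. measure R {p \<in> K. s n p = f} * f w)" by (simp add: sp)
  qed
  note P = Pq[OF assms(2) sets(1)] lim[OF assms(2) sets(1)] meas[OF assms(2) sets(1)] sum[OF assms(2) sets(1)]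
  note Q = Pq[OF assms(3) sets(2)] lim[OF assms(3) sets(2)] meas[OF assms(3) sets(2)] sum[OF assms(3) sets(2)]
  note [measurable] = P(3,4) Q(3,4)
  let ?b = "\<lambda>w. (\<integral>p. G p w \<partial>P) - (\<integral>p. G p w \<partial>Q)"
  have mean_lim: "(\<lambda>n. \<integral>\<^sup>+p. ennreal (L2_norm W (\<lambda>w. F p w - s n p w)) \<partial>?TV) \<longlonglongrightarrow> 0"
  proof (rule tendsto_sandwich[of "\<lambda>_. 0"])
    show "\<forall>\<^sub>F n in sequentially. (\<integral>\<^sup>+p. ennreal (L2_norm W (\<lambda>w. F p w - s n p w)) \<partial>?TV)
        \<le> (\<integral>\<^sup>+p. ennreal (sqrt (L * dist p (q n p))) \<partial>?TV)"
      by (intro always_eventually allI nn_integral_mono ennreal_leI norm_le) (simp add: space)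
    have "(\<lambda>n. \<integral>\<^sup>+p. ennreal (sqrt (L * dist p (q n p))) \<partial>?TV) \<longlonglongrightarrow> (\<integral>\<^sup>+p. 0 \<partial>?TV)"
    proof (rule nn_integral_dominated_convergence[where w = "\<lambda>_. ennreal (sqrt (\<bar>L\<bar> * (3 * B)))"])
      show "(\<lambda>p. ennreal (sqrt (L * dist p (q n p)))) \<in> borel_measurable ?TV" for n
        using qm[of ?TV n] borel[of ?TV] by simp
      show "AE p in ?TV. ennreal (sqrt (L * dist p (q n p))) \<le> ennreal (sqrt (\<bar>L\<bar> * (3 * B)))" for n
        by (intro AE_I2 ennreal_leI real_sqrt_le_mono L') (simp add: space)
      show "AE p in ?TV. (\<lambda>n. ennreal (sqrt (L * dist p (q n p)))) \<longlonglongrightarrow> 0"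
        using tendsto_ennrealI[OF sqrt_lim] by (intro AE_I2) (simp add: space)
      show "(\<integral>\<^sup>+p. ennreal (sqrt (\<bar>L\<bar> * (3 * B))) \<partial>?TV) < \<infinity>"
        using TV.emeasure_finite[of "space ?TV"] by (simp add: ennreal_mult_eq_top_iff less_top[symmetric])
    qed auto
    then show "(\<lambda>n. \<integral>\<^sup>+p. ennreal (sqrt (L * dist p (q n p))) \<partial>?TV) \<longlonglongrightarrow> 0" by simp
  qed auto
  have b_lim: "(\<lambda>n. L2_norm W (\<lambda>w. ?b w - (\<Sum>f\<in>s n ` K. ?\<eta> {p \<in> K. s n p = f} * f w))) \<longlonglongrightarrow> 0"
  proof (rule tendsto_sandwich[of "\<lambda>_. 0"])
    let ?\<delta> = "\<lambda>n. 2 * (\<integral>p. L * dist p (q n p) \<partial>P) + 2 * (\<integral>p. L * dist p (q n p) \<partial>Q)"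
    have "L2_norm W (\<lambda>w. ?b w - (\<Sum>f\<in>s n ` K. ?\<eta> {p \<in> K. s n p = f} * f w)) \<le> sqrt (?\<delta> n)" for n
    proof -
      let ?e = "\<lambda>R w. (\<integral>p. G p w \<partial>R) - (\<integral>p. s n p w \<partial>R)"
      have eP: "?e P \<in> L2_fun W"
      proof (rule L2[of _ "C + C"])
        show "\<bar>?e P w\<bar> \<le> C + C" for w
          by (rule order_trans[OF abs_triangle_ineq4 add_mono[OF P.abs_integral_bounded P.abs_integral_bounded]])
             (auto simp: s_def bnd C)
      qed measurable
      have eQ: "?e Q \<in> L2_fun W"
      proof (rule L2[of _ "C + C"])
        show "\<bar>?e Q w\<bar> \<le> C + C" for w
          by (rule order_trans[OF abs_triangle_ineq4 add_mono[OF Q.abs_integral_bounded Q.abs_integral_bounded]])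
             (auto simp: s_def bnd C)
      qed measurable
      note e = eP eQ
      \<comment> \<open>The errors of the two measures are separated by \<open>(s - t)\<^sup>2 \<le> 2 s\<^sup>2 + 2 t\<^sup>2\<close>.\<close>
      have "(\<integral>w. (?e P w - ?e Q w)\<^sup>2 \<partial>W) \<le> (\<integral>w. 2 * (?e P w)\<^sup>2 + 2 * (?e Q w)\<^sup>2 \<partial>W)"
      proof (rule integral_mono')
        show "integrable W (\<lambda>w. 2 * (?e P w)\<^sup>2 + 2 * (?e Q w)\<^sup>2)" using e by (simp add: L2_fun_def)
        show "(?e P w - ?e Q w)\<^sup>2 \<le> 2 * (?e P w)\<^sup>2 + 2 * (?e Q w)\<^sup>2" for w
          using zero_le_power2[of "?e P w + ?e Q w"] by (simp add: power2_eq_square algebra_simps)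
      qed simp
      also have "\<dots> = 2 * (\<integral>w. (?e P w)\<^sup>2 \<partial>W) + 2 * (\<integral>w. (?e Q w)\<^sup>2 \<partial>W)"
        using e by (simp add: L2_fun_def)
      also have "\<dots> \<le> ?\<delta> n" using P(1)[of n] Q(1)[of n] by simp
      finally have "(\<integral>w. (?e P w - ?e Q w)\<^sup>2 \<partial>W) \<le> ?\<delta> n" .
      moreover have "?b w - (\<Sum>f\<in>s n ` K. ?\<eta> {p \<in> K. s n p = f} * f w) = ?e P w - ?e Q w" for w
        by (simp add: P(5) Q(5) left_diff_distrib sum_subtractf)
      ultimately show ?thesis by (simp only: L2_norm_def real_sqrt_le_iff)
    qed
    then show "\<forall>\<^sub>F n in sequentially. L2_norm W (\<lambda>w. ?b w - (\<Sum>f\<in>s n ` K. ?\<eta> {p \<in> K. s n p = f} * f w)) \<le> sqrt (?\<delta> n)"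
      by simp
    have "(\<lambda>n. sqrt (?\<delta> n)) \<longlonglongrightarrow> sqrt (2 * 0 + 2 * 0)"
      by (intro tendsto_intros P(2) Q(2))
    then show "(\<lambda>n. sqrt (?\<delta> n)) \<longlonglongrightarrow> 0" by simp
  qed (auto simp: L2_norm_def)
  show ?thesis
    unfolding has_L2_bochner_integral_def space
  proof (intro conjI exI[of _ s] ballI allI)
    show "?b \<in> L2_fun W"
      by (intro L2[of _ "C + C"] order_trans[OF abs_triangle_ineq4 add_mono] P.abs_integral_bounded Q.abs_integral_bounded)
         (auto simp: bnd C)
    show "F p \<in> L2_fun W" if "p \<in> K" for p unfolding F[OF that] by (rule L2[OF Gsec bnd])
    show "s n p \<in> L2_fun W" for n p unfolding s_def by (rule L2[OF Gsec bnd])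
    show "AE p in ?TV. (\<lambda>n. L2_norm W (\<lambda>w. F p w - s n p w)) \<longlonglongrightarrow> 0"
    proof (rule AE_I2)
      fix p assume "p \<in> space ?TV"
      then have p: "p \<in> K" by (simp add: space)
      show "(\<lambda>n. L2_norm W (\<lambda>w. F p w - s n p w)) \<longlonglongrightarrow> 0"
        by (rule tendsto_sandwich[OF _ _ tendsto_const sqrt_lim[OF p]])
           (use norm_le[OF p] in \<open>auto simp: L2_norm_def\<close>)
    qed
  qed (use s mean_lim b_lim in auto)
qed

section \<open>Half-spaces and distances\<close>

text \<open>
  By rotation invariance \<open>z\<close> may be assumed to be a multiple of a coordinate vector.
\<close>

lemma uniform_sphere_mean_abs_inner:
  fixes z :: "real ^ 'n"
  shows "(\<integral>\<theta>. \<bar>\<theta> \<bullet> z\<bar> \<partial>uniform_sphere) = norm z * mean_abs_coord TYPE('n)"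
proof -
  define i where "i = (SOME i :: 'n. True)"
  have "norm (norm z *\<^sub>R axis i (1::real)) = norm z" by (simp add: norm_axis_1)
  then obtain T where T: "orthogonal_transformation T" "T (norm z *\<^sub>R axis i (1::real)) = z"
    using orthogonal_transformation_exists[of "norm z *\<^sub>R axis i (1::real)" z] by auto
  have c: "T \<theta> \<bullet> z = norm z * \<theta> $ i" for \<theta>
    using T by (metis (no_types) orthogonal_transformation_def inner_scaleR_right cart_eq_inner_axis)
  have "continuous_on UNIV T" using T(1)
    by (simp add: linear_continuous_on linear_conv_bounded_linear[symmetric] orthogonal_transformation_linear)
  then have Tm: "T \<in> uniform_sphere \<rightarrow>\<^sub>M uniform_sphere"
    unfolding measurable_cong_sets[OF sets_uniform_sphere sets_uniform_sphere] using T(1)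
    by (intro measurable_restrict_space3 borel_measurable_continuous_onI)
       (auto simp: orthogonal_transformation)
  have m: "(\<lambda>\<theta>. \<bar>\<theta> \<bullet> z\<bar>) \<in> borel_measurable (uniform_sphere :: (real ^ 'n) measure)"
    unfolding measurable_cong_sets[OF sets_uniform_sphere refl]
    by (intro measurable_restrict_space1 borel_measurable_continuous_onI continuous_intros)
  have "(\<integral>\<theta>. \<bar>\<theta> \<bullet> z\<bar> \<partial>uniform_sphere) = (\<integral>\<theta>. \<bar>\<theta> \<bullet> z\<bar> \<partial>distr uniform_sphere uniform_sphere T)"
    by (simp add: uniform_sphere_invariant[OF T(1)])
  also have "\<dots> = (\<integral>\<theta>. \<bar>T \<theta> \<bullet> z\<bar> \<partial>uniform_sphere)"
    using Tm m by (rule integral_distr)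
  also have "\<dots> = norm z * mean_abs_coord TYPE('n)"
    by (simp add: c abs_mult mean_abs_coord_eq[of i])
  finally show ?thesis .
qed

text \<open>
  On the unit sphere the sum of the absolute coordinates is at least the Euclidean norm \<open>1\<close>, and all
  coordinates have the same mean absolute value.
\<close>

lemma mean_abs_coord_pos: "mean_abs_coord TYPE('n::finite) > 0"
proof -
  interpret S: prob_space "uniform_sphere :: (real ^ 'n) measure" by (rule prob_space_uniform_sphere)
  have int: "integrable uniform_sphere (\<lambda>\<theta> :: real ^ 'n. \<bar>\<theta> $ i\<bar>)" for i
  proof (rule S.integrable_bounded)
    show "(\<lambda>\<theta> :: real ^ 'n. \<bar>\<theta> $ i\<bar>) \<in> borel_measurable uniform_sphere"
      unfolding measurable_cong_sets[OF sets_uniform_sphere refl]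
      by (intro measurable_restrict_space1 borel_measurable_continuous_onI continuous_intros)
    show "\<bar>\<bar>\<theta> $ i\<bar>\<bar> \<le> 1" if "\<theta> \<in> space uniform_sphere" for \<theta> :: "real ^ 'n"
      using that component_le_norm_cart[of \<theta> i] by simp
  qed
  have "1 = (\<integral>\<theta>. (1::real) \<partial>(uniform_sphere :: (real ^ 'n) measure))" using S.prob_space by simp
  also have "\<dots> \<le> (\<integral>\<theta>. (\<Sum>i\<in>UNIV. \<bar>(\<theta> :: real ^ 'n) $ i\<bar>) \<partial>uniform_sphere)"
    using int by (intro integral_mono) (auto intro: order_trans[OF _ norm_le_l1_cart])
  also have "\<dots> = real CARD('n) * mean_abs_coord TYPE('n)"
    using int by (simp add: mean_abs_coord_eq[symmetric])
  finally show ?thesis by (metis less_le_trans zero_less_one zero_less_mult_pos of_nat_0_less_iff zero_less_card_finite)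
qed

lemma hs_kappa_pos: "R > 0 \<Longrightarrow> hs_kappa TYPE('n::finite) R > 0"
  by (simp add: hs_kappa_def mean_abs_coord_pos)

text \<open>
  The indicator of the open half-space \<open>(\<theta>, t)\<close> in the whole space rather than in \<open>X\<close> or \<open>Y\<close>: it is
  jointly Borel in the point and the half-space.
\<close>

abbreviation halfspace_ind :: "'a::real_inner \<Rightarrow> 'a \<times> real \<Rightarrow> real" where
  "halfspace_ind x \<xi> \<equiv> indicator {z. snd \<xi> < fst \<xi> \<bullet> z} x"

lemma measurable_halfspace_ind:
  "(\<lambda>(x, \<xi>). halfspace_ind x \<xi>) \<in> borel_measurable (borel :: ('a::euclidean_space \<times> ('a \<times> real)) measure)"
proof -
  have "open {z :: 'a \<times> ('a \<times> real). snd (snd z) < fst (snd z) \<bullet> fst z}"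
    by (intro open_Collect_less continuous_intros)
  then have "indicat_real {z :: 'a \<times> ('a \<times> real). snd (snd z) < fst (snd z) \<bullet> fst z} \<in> borel_measurable (borel :: _ measure)"
    by (intro borel_measurable_indicator) auto
  moreover have "indicat_real {z :: 'a \<times> ('a \<times> real). snd (snd z) < fst (snd z) \<bullet> fst z} = (\<lambda>(x, \<xi>). halfspace_ind x \<xi>)"
    by (auto simp: fun_eq_iff indicator_def)
  ultimately show ?thesis by (simp only:)
qed

lemma measurable_halfspace_section:
  assumes "(\<lambda>z. z) \<in> M \<rightarrow>\<^sub>M borel"
  shows "(\<lambda>z. halfspace_ind z \<xi>) \<in> borel_measurable M"
proof -
  have "open {z. snd \<xi> < fst \<xi> \<bullet> z}" by (intro open_Collect_less continuous_intros)
  then show ?thesis by (intro measurable_compose[OF assms] borel_measurable_indicator) auto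
qed

lemma measurable_hs_measure_ident: "(\<lambda>\<xi>. \<xi>) \<in> (hs_measure R :: ((real ^ 'n) \<times> real) measure) \<rightarrow>\<^sub>M borel"
proof -
  have s: "sets (hs_measure R :: ((real ^ 'n) \<times> real) measure) = sets (uniform_sphere \<Otimes>\<^sub>M restrict_space lborel {-R..R})"
    by (simp add: hs_measure_def)
  have "(\<lambda>\<theta>. \<theta>) \<in> (uniform_sphere :: (real ^ 'n) measure) \<rightarrow>\<^sub>M borel"
    unfolding measurable_cong_sets[OF sets_uniform_sphere refl] by (rule measurable_restrict_space1) simp
  moreover have "(\<lambda>t. t) \<in> restrict_space lborel {-R..R} \<rightarrow>\<^sub>M borel"
    by (rule measurable_restrict_space1) simp
  ultimately have "(\<lambda>\<xi>. (fst \<xi>, snd \<xi>)) \<in> (uniform_sphere :: (real ^ 'n) measure) \<Otimes>\<^sub>M restrict_space lborel {-R..R} \<rightarrow>\<^sub>M borel \<Otimes>\<^sub>M borel"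
    by (intro measurable_Pair measurable_compose[OF measurable_fst] measurable_compose[OF measurable_snd])
  then show ?thesis
    unfolding measurable_cong_sets[OF s refl] by (simp add: borel_prod)
qed

lemma integral_hs_measure:
  fixes f :: "(real ^ 'n) \<times> real \<Rightarrow> real"
  assumes R: "R > 0" and [measurable]: "f \<in> borel_measurable borel" and bnd: "\<And>\<xi>. \<bar>f \<xi>\<bar> \<le> C"
  shows "(\<integral>\<xi>. f \<xi> \<partial>hs_measure R)
    = 1 / (2 * R) * (\<integral>\<theta>. (\<integral>t. indicator {-R..R} t * f (\<theta>, t) \<partial>lborel) \<partial>uniform_sphere)"
proof -
  let ?I = "restrict_space lborel {-R..R}"
  interpret S: prob_space "uniform_sphere :: (real ^ 'n) measure" by (rule prob_space_uniform_sphere)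
  interpret I: finite_measure ?I
    using R by (intro finite_measureI) (simp add: space_restrict_space emeasure_restrict_space)
  interpret SI: pair_sigma_finite "uniform_sphere :: (real ^ 'n) measure" ?I ..
  interpret SI': finite_measure "(uniform_sphere :: (real ^ 'n) measure) \<Otimes>\<^sub>M ?I"
    by (rule finite_measure_pair_measure) unfold_locales
  have fm: "f \<in> borel_measurable (uniform_sphere \<Otimes>\<^sub>M ?I)"
    using measurable_compose[OF measurable_hs_measure_ident[of R] assms(2)]
    by (simp add: hs_measure_def)
  have int: "integrable (uniform_sphere \<Otimes>\<^sub>M ?I) f"
    by (rule SI'.integrable_const_bound[of _ C]) (use bnd fm in auto)
  have "(\<integral>\<xi>. f \<xi> \<partial>hs_measure R) = (\<integral>\<xi>. 1 / (2 * R) * f \<xi> \<partial>(uniform_sphere \<Otimes>\<^sub>M ?I))"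
    unfolding hs_measure_def using R fm by (subst integral_density) auto
  also have "\<dots> = 1 / (2 * R) * (\<integral>\<theta>. (\<integral>t. f (\<theta>, t) \<partial>?I) \<partial>uniform_sphere)"
    using SI.integral_fst'[OF int] by simp
  also have "(\<integral>\<theta>. (\<integral>t. f (\<theta>, t) \<partial>?I) \<partial>uniform_sphere)
      = (\<integral>\<theta>. (\<integral>t. indicator {-R..R} t * f (\<theta>, t) \<partial>lborel) \<partial>uniform_sphere)"
    by (subst integral_restrict_space) auto
  finally show ?thesis .
qed

text \<open>
  The thresholds \<open>t\<close> that separate \<open>s\<close> from \<open>s'\<close> form the interval between them, cut off at \<open>\<plusminus>R\<close>.
\<close>

lemma integral_threshold_difference:
  fixes s s' R :: real
  defines "g \<equiv> \<lambda>t. indicator {-R..R} t * (indicator {..<s} t - indicator {..<s'} t)\<^sup>2 :: real"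
  shows "(\<integral>t. g t \<partial>lborel) \<le> \<bar>s - s'\<bar>"
    and "\<bar>s\<bar> \<le> R \<Longrightarrow> \<bar>s'\<bar> \<le> R \<Longrightarrow> (\<integral>t. g t \<partial>lborel) = \<bar>s - s'\<bar>"
proof -
  have g: "g = indicator ({-R..R} \<inter> {min s s'..<max s s'})"
    by (auto simp: g_def fun_eq_iff indicator_def)
  then have "(\<integral>t. g t \<partial>lborel) = measure lborel ({-R..R} \<inter> {min s s'..<max s s'})" by simp
  also have "\<dots> \<le> measure lborel {min s s'..<max s s'}"
    by (intro measure_mono_fmeasurable) (auto simp: fmeasurable_def)
  finally show "(\<integral>t. g t \<partial>lborel) \<le> \<bar>s - s'\<bar>" by auto
  assume "\<bar>s\<bar> \<le> R" "\<bar>s'\<bar> \<le> R"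
  then have "{-R..R} \<inter> {min s s'..<max s s'} = {min s s'..<max s s'}" by auto
  then have "(\<integral>t. g t \<partial>lborel) = measure lborel {min s s'..<max s s'}" using g by simp
  then show "(\<integral>t. g t \<partial>lborel) = \<bar>s - s'\<bar>" by auto
qed

text \<open>
  A Crofton formula: the measure of the half-spaces that separate two points is proportional to
  their distance. For a fixed direction \<open>\<theta>\<close> the separating offsets have total length \<open>\<bar>\<theta> \<bullet> (x - x')\<bar>\<close>,
  whose mean is \<open>norm (x - x')\<close> times the mean absolute coordinate. Outside the ball of radius \<open>R\<close> some separating
  offsets may be missed and only the inequality survives; the approximants of Bochner integrals
  need it there.
\<close>

lemma
  fixes x x' :: "real ^ 'n"
  assumes R: "R > 0"
  shows halfspace_distance_le:
      "(\<integral>\<xi>. (halfspace_ind x \<xi> - halfspace_ind x' \<xi>)\<^sup>2 \<partial>hs_measure R) \<le> dist x x' / hs_kappa TYPE('n) R"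
    and halfspace_distance_eq: "norm x \<le> R \<Longrightarrow> norm x' \<le> R \<Longrightarrow>
      (\<integral>\<xi>. (halfspace_ind x \<xi> - halfspace_ind x' \<xi>)\<^sup>2 \<partial>hs_measure R) = dist x x' / hs_kappa TYPE('n) R"
proof -
  interpret S: prob_space "uniform_sphere :: (real ^ 'n) measure" by (rule prob_space_uniform_sphere)
  define g :: "real ^ 'n \<Rightarrow> real" where
    "g \<theta> = (\<integral>t. indicator {-R..R} t * (indicator {..<\<theta> \<bullet> x} t - indicator {..<\<theta> \<bullet> x'} t)\<^sup>2 \<partial>lborel)" for \<theta>
  have [measurable]: "halfspace_ind y \<in> borel_measurable borel" for y :: "real ^ 'n"
    using measurable_compose[OF _ measurable_halfspace_ind, of "\<lambda>\<xi>. (y, \<xi>)"] by (simp add: borel_prod[symmetric])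
  have "(\<integral>\<xi>. (halfspace_ind x \<xi> - halfspace_ind x' \<xi>)\<^sup>2 \<partial>hs_measure R) = 1 / (2 * R) *
     (\<integral>\<theta>. (\<integral>t. indicator {-R..R} t * (halfspace_ind x (\<theta>, t) - halfspace_ind x' (\<theta>, t))\<^sup>2 \<partial>lborel) \<partial>uniform_sphere)"
    by (rule integral_hs_measure[OF R, of _ 1]) (measurable, auto simp: indicator_def)
  also have "\<dots> = 1 / (2 * R) * (\<integral>\<theta>. g \<theta> \<partial>uniform_sphere)"
    unfolding g_def by (simp add: indicator_def)
  finally have eq: "(\<integral>\<xi>. (halfspace_ind x \<xi> - halfspace_ind x' \<xi>)\<^sup>2 \<partial>hs_measure R) = 1 / (2 * R) * (\<integral>\<theta>. g \<theta> \<partial>uniform_sphere)" .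
  have mean: "1 / (2 * R) * (\<integral>\<theta>. \<bar>\<theta> \<bullet> (x - x')\<bar> \<partial>(uniform_sphere :: (real ^ 'n) measure)) = dist x x' / hs_kappa TYPE('n) R"
    by (simp add: uniform_sphere_mean_abs_inner hs_kappa_def dist_norm)
  have "(\<integral>\<theta>. g \<theta> \<partial>uniform_sphere) \<le> (\<integral>\<theta>. \<bar>\<theta> \<bullet> (x - x')\<bar> \<partial>uniform_sphere)"
  proof (rule integral_mono')
    show "integrable uniform_sphere (\<lambda>\<theta> :: real ^ 'n. \<bar>\<theta> \<bullet> (x - x')\<bar>)"
    proof (rule S.integrable_bounded)
      show "(\<lambda>\<theta>. \<bar>\<theta> \<bullet> (x - x')\<bar>) \<in> borel_measurable (uniform_sphere :: (real ^ 'n) measure)"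
        unfolding measurable_cong_sets[OF sets_uniform_sphere refl]
        by (intro measurable_restrict_space1 borel_measurable_continuous_onI continuous_intros)
      show "\<bar>\<bar>\<theta> \<bullet> (x - x')\<bar>\<bar> \<le> norm (x - x')" if "\<theta> \<in> space uniform_sphere" for \<theta>
        using that Cauchy_Schwarz_ineq2[of \<theta> "x - x'"] by simp
    qed
    show "g \<theta> \<le> \<bar>\<theta> \<bullet> (x - x')\<bar>" for \<theta>
      unfolding g_def inner_diff_right by (rule integral_threshold_difference)
  qed simp
  then have "1 / (2 * R) * (\<integral>\<theta>. g \<theta> \<partial>uniform_sphere) \<le> 1 / (2 * R) * (\<integral>\<theta>. \<bar>\<theta> \<bullet> (x - x')\<bar> \<partial>uniform_sphere)"
    using R by (intro mult_left_mono) auto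
  then show "(\<integral>\<xi>. (halfspace_ind x \<xi> - halfspace_ind x' \<xi>)\<^sup>2 \<partial>hs_measure R) \<le> dist x x' / hs_kappa TYPE('n) R"
    unfolding eq mean .
  assume n: "norm x \<le> R" "norm x' \<le> R"
  have "g \<theta> = \<bar>\<theta> \<bullet> (x - x')\<bar>" if "\<theta> \<in> space uniform_sphere" for \<theta>
    unfolding g_def inner_diff_right
  proof (rule integral_threshold_difference)
    have "\<bar>\<theta> \<bullet> y\<bar> \<le> norm y" for y using Cauchy_Schwarz_ineq2[of \<theta> y] that by simp
    then show "\<bar>\<theta> \<bullet> x\<bar> \<le> R" "\<bar>\<theta> \<bullet> x'\<bar> \<le> R" using n order_trans by blast+
  qed
  then have "(\<integral>\<theta>. g \<theta> \<partial>uniform_sphere) = (\<integral>\<theta>. \<bar>\<theta> \<bullet> (x - x')\<bar> \<partial>uniform_sphere)"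
    by (rule Bochner_Integration.integral_cong[OF refl])
  then show "(\<integral>\<xi>. (halfspace_ind x \<xi> - halfspace_ind x' \<xi>)\<^sup>2 \<partial>hs_measure R) = dist x x' / hs_kappa TYPE('n) R"
    unfolding eq mean[symmetric] by simp
qed

lemma borel_probsD:
  fixes \<mu> :: "'a::topological_space measure"
  assumes "\<mu> \<in> borel_probs S"
  shows "prob_space \<mu>" "sets \<mu> = sets (restrict_space borel S)" "space \<mu> = S" "(\<lambda>x. x) \<in> \<mu> \<rightarrow>\<^sub>M borel"
proof -
  show "prob_space \<mu>" and s: "sets \<mu> = sets (restrict_space borel S)" using assms by (auto simp: borel_probs_def)
  show "space \<mu> = S" using sets_eq_imp_space_eq[OF s] by (simp add: space_restrict_space)
  show "(\<lambda>x. x) \<in> \<mu> \<rightarrow>\<^sub>M borel"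
    unfolding measurable_cong_sets[OF s refl] by (rule measurable_restrict_space1) simp
qed

text \<open>
  The half-spaces are those of the whole space instead of their traces on the set that carries \<open>\<mu>\<close>,
  so that measurability does not depend on that set; on it, the function coincides with \<open>hs_embed\<close>.
\<close>

definition centered_halfspace :: "real \<Rightarrow> (real ^ 'n) measure \<Rightarrow> real ^ 'n \<Rightarrow> (real ^ 'n) \<times> real \<Rightarrow> real" where
  "centered_halfspace R \<mu> x \<xi> =
     sqrt (hs_kappa TYPE('n) R) * (halfspace_ind x \<xi> - (\<integral>z. halfspace_ind z \<xi> \<partial>\<mu>))"

lemma hs_embed_eq_centered_halfspace:
  assumes \<mu>: "\<mu> \<in> borel_probs S" and x: "x \<in> S"
  shows "hs_embed S R \<mu> x = centered_halfspace R \<mu> x"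
proof
  fix \<xi>
  note \<mu> = borel_probsD[OF \<mu>]
  have *: "{z. snd \<xi> < fst \<xi> \<bullet> z} \<inter> S = half_space S \<xi>"
    by (auto simp: half_space_def split_beta)
  have "(\<integral>z. halfspace_ind z \<xi> \<partial>\<mu>) = measure \<mu> (half_space S \<xi>)"
    by (simp add: \<mu> *)
  moreover have "halfspace_ind x \<xi> = (indicator (half_space S \<xi>) x :: real)"
    using x by (auto simp: half_space_def split_beta indicator_def)
  ultimately show "hs_embed S R \<mu> x \<xi> = centered_halfspace R \<mu> x \<xi>"
    by (simp add: hs_embed_def centered_halfspace_def)
qed

lemma measurable_hs_measure:
  assumes "f \<in> borel_measurable (borel :: ('a::euclidean_space \<times> ((real ^ 'n) \<times> real)) measure)" "g \<in> M \<rightarrow>\<^sub>M borel"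
  shows "(\<lambda>(x, \<xi>). f (g x, \<xi>)) \<in> borel_measurable (M \<Otimes>\<^sub>M hs_measure R)"
proof -
  have "(\<lambda>(x, \<xi>). (g x, \<xi>)) \<in> M \<Otimes>\<^sub>M hs_measure R \<rightarrow>\<^sub>M borel \<Otimes>\<^sub>M borel"
    unfolding split_beta'
    by (intro measurable_Pair measurable_compose[OF measurable_fst assms(2)]
        measurable_compose[OF measurable_snd measurable_hs_measure_ident])
  from measurable_compose[OF this] assms(1) show ?thesis by (simp add: borel_prod split_beta')
qed

lemma centered_feature_map_halfspace:
  fixes \<mu> :: "(real ^ 'n) measure"
  assumes R: "R > 0" and \<mu>: "\<mu> \<in> borel_probs S"
  shows "centered_feature_map \<mu> (hs_measure R) (centered_halfspace R \<mu>) (sqrt (hs_kappa TYPE('n) R))"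
proof -
  note \<mu>' = borel_probsD[OF \<mu>]
  interpret M: prob_space \<mu> by (rule \<mu>')
  interpret W: prob_space "hs_measure R :: ((real ^ 'n) \<times> real) measure" by (rule prob_space_hs_measure[OF R])
  interpret MW: pair_prob_space \<mu> "hs_measure R :: ((real ^ 'n) \<times> real) measure" ..
  have ind: "(\<lambda>(x, \<xi>). halfspace_ind x \<xi>) \<in> borel_measurable (\<mu> \<Otimes>\<^sub>M hs_measure R)"
    using measurable_hs_measure[OF measurable_halfspace_ind \<mu>'(4), of R] by simp
  have [measurable]: "(\<lambda>\<xi>. \<integral>z. halfspace_ind z \<xi> \<partial>\<mu>) \<in> borel_measurable (hs_measure R)"
    using measurable_compose[OF measurable_pair_swap' ind] by (intro M.borel_measurable_lebesgue_integral) (simp add: split_beta')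
  have sec: "(\<lambda>z. halfspace_ind z \<xi> :: real) \<in> borel_measurable \<mu>" for \<xi>
    by (rule measurable_halfspace_section[OF \<mu>'(4)])
  show ?thesis
  proof
    show "case_prod (centered_halfspace R \<mu>) \<in> borel_measurable (\<mu> \<Otimes>\<^sub>M hs_measure R)"
      unfolding centered_halfspace_def using ind by (simp add: split_beta' del: Bochner_Integration.integral_indicator)
    show "\<bar>centered_halfspace R \<mu> x \<xi>\<bar> \<le> sqrt (hs_kappa TYPE('n) R)" for x \<xi>
    proof -
      define m where "m = (\<integral>z. halfspace_ind z \<xi> \<partial>\<mu>)"
      have "\<bar>m\<bar> \<le> 1" unfolding m_def by (rule M.abs_integral_bounded) (auto simp: indicator_def)
      moreover have "0 \<le> m" unfolding m_def by simp
      ultimately have "\<bar>halfspace_ind x \<xi> - m\<bar> \<le> 1" by (auto split: split_indicator)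
      from mult_left_mono[OF this, of "sqrt (hs_kappa TYPE('n) R)"] hs_kappa_pos[OF R, where 'n = 'n]
      show ?thesis by (simp add: centered_halfspace_def abs_mult m_def)
    qed
    show "(\<integral>x. centered_halfspace R \<mu> x \<xi> \<partial>\<mu>) = 0" for \<xi>
    proof -
      have "integrable \<mu> (\<lambda>x. halfspace_ind x \<xi>)"
        by (rule M.integrable_bounded[of _ 1]) (use sec in \<open>auto simp: indicator_def\<close>)
      then show ?thesis by (simp add: centered_halfspace_def M.prob_space del: Bochner_Integration.integral_indicator)
    qed
  qed
qed

text \<open>
  The constant \<open>hs_kappa\<close> is chosen to absorb the factor of the Crofton formula; the subtracted means
  cancel. So the distance itself, not its square, is the squared \<open>L\<^sup>2\<close> distance of the embedded points.
\<close>

lemma dist_eq_centered_halfspace: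
  fixes \<mu> :: "(real ^ 'n) measure"
  assumes R: "R > 0" and "norm x \<le> R" "norm x' \<le> R"
  shows "dist x x' = (\<integral>\<xi>. (centered_halfspace R \<mu> x \<xi> - centered_halfspace R \<mu> x' \<xi>)\<^sup>2 \<partial>hs_measure R)"
proof -
  have k: "hs_kappa TYPE('n) R > 0" by (rule hs_kappa_pos[OF R])
  have "(centered_halfspace R \<mu> x \<xi> - centered_halfspace R \<mu> x' \<xi>)\<^sup>2
      = hs_kappa TYPE('n) R * (halfspace_ind x \<xi> - halfspace_ind x' \<xi>)\<^sup>2" for \<xi>
    using k by (simp add: centered_halfspace_def right_diff_distrib[symmetric] power_mult_distrib)
  then show ?thesis using halfspace_distance_eq[OF assms] k by simp
qed

text \<open>
  Couplings carry the product of the trace \<sigma>-algebras, signed measures on \<open>X \<times> Y\<close> the trace of the Borel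
  \<sigma>-algebra of the product; second countability makes them the same.
\<close>

lemma sets_restrict_space_pair:
  fixes X :: "'a::second_countable_topology set" and Y :: "'b::second_countable_topology set"
  assumes "sets \<mu> = sets (restrict_space borel X)" "sets \<nu> = sets (restrict_space borel Y)"
    and X: "X \<in> sets borel" and Y: "Y \<in> sets borel"
  shows "sets (\<mu> \<Otimes>\<^sub>M \<nu>) = sets (restrict_space borel (X \<times> Y))"
proof -
  let ?P = "restrict_space borel X \<Otimes>\<^sub>M restrict_space borel Y" and ?Q = "restrict_space borel (X \<times> Y)"
  have "sets ?P = sets ?Q"
  proof (rule antisym)
    show "sets ?P \<subseteq> sets ?Q"
    proof (rule sets_pair_in_sets)
      fix A B assume "A \<in> sets (restrict_space borel X)" "B \<in> sets (restrict_space borel Y)"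
      then have "A \<in> sets borel" "A \<subseteq> X" "B \<in> sets borel" "B \<subseteq> Y"
        using X Y by (auto simp: sets_restrict_space_iff)
      moreover then have "A \<times> B \<in> sets borel" by (simp add: borel_prod[symmetric])
      moreover have "X \<times> Y \<in> sets borel" using X Y by (simp add: borel_prod[symmetric])
      ultimately show "A \<times> B \<in> sets ?Q" by (auto simp: sets_restrict_space_iff)
    qed
    have "(\<lambda>p. (fst p, snd p)) \<in> ?P \<rightarrow>\<^sub>M borel \<Otimes>\<^sub>M borel"
      by (intro measurable_Pair measurable_compose[OF measurable_fst] measurable_compose[OF measurable_snd]
          measurable_restrict_space1) auto
    then have id: "(\<lambda>p. p) \<in> ?P \<rightarrow>\<^sub>M borel" by (simp add: borel_prod)
    show "sets ?Q \<subseteq> sets ?P"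
    proof
      fix A assume "A \<in> sets ?Q"
      then obtain B where "B \<in> sets borel" "A = (X \<times> Y) \<inter> B" by (auto simp: sets_restrict_space)
      then show "A \<in> sets ?P"
        using measurable_sets[OF id, of B] by (simp add: space_pair_measure space_restrict_space Int_commute)
    qed
  qed
  then show ?thesis using sets_pair_measure_cong[OF assms(1,2)] by simp
qed

section \<open>Duality\<close>

lemma coupled_feature_maps_halfspace:
  fixes \<mu> :: "(real ^ 'm) measure" and \<nu> :: "(real ^ 'n) measure"
  assumes "RX > 0" "RY > 0" "\<mu> \<in> borel_probs X" "\<nu> \<in> borel_probs Y" "\<gamma> \<in> couplings \<mu> \<nu>"
  shows "coupled_feature_maps \<mu> (hs_measure RX) (centered_halfspace RX \<mu>) (sqrt (hs_kappa TYPE('m) RX))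
    \<nu> (hs_measure RY) (centered_halfspace RY \<nu>) (sqrt (hs_kappa TYPE('n) RY)) \<gamma>"
  using assms by (intro coupled_feature_maps.intro coupled_feature_maps_axioms.intro centered_feature_map_halfspace)

text \<open>
  Expanding \<open>(1\<^sub>H(x) - \<mu>(H)) (1\<^sub>G(y) - \<nu>(G))\<close> and integrating against \<open>\<gamma>\<close> leaves \<open>\<gamma>(H \<times> G) - \<mu>(H) \<nu>(G)\<close>. So, up
  to the scaling, the cross moment is the integral of \<open>hs_pair\<close> against the signed measure
  \<open>\<gamma> - \<mu> \<otimes> \<nu>\<close>, and the latter has total variation at most \<open>2\<close>.
\<close>

lemma cross_moment_in_dual_set:
  fixes X :: "(real ^ 'm) set" and Y :: "(real ^ 'n) set"
  assumes X: "X \<in> sets borel" "bounded X" and Y: "Y \<in> sets borel" "bounded Y"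
    and R: "RX > 0" "RY > 0"
    and \<mu>: "\<mu> \<in> borel_probs X" and \<nu>: "\<nu> \<in> borel_probs Y" and \<gamma>: "\<gamma> \<in> couplings \<mu> \<nu>"
  shows "(\<lambda>w. 8 * (\<integral>p. centered_halfspace RX \<mu> (fst p) (fst w) * centered_halfspace RY \<nu> (snd p) (snd w) \<partial>\<gamma>))
    \<in> dual_set X Y RX RY"
proof -
  note \<mu>' = borel_probsD[OF \<mu>] and \<nu>' = borel_probsD[OF \<nu>]
  interpret C: coupled_feature_maps \<mu> "hs_measure RX" "centered_halfspace RX \<mu>" "sqrt (hs_kappa TYPE('m) RX)"
    \<nu> "hs_measure RY" "centered_halfspace RY \<nu>" "sqrt (hs_kappa TYPE('n) RY)" \<gamma>
    by (rule coupled_feature_maps_halfspace[OF R \<mu> \<nu> \<gamma>])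
  interpret MN: pair_prob_space \<mu> \<nu> ..
  let ?N = "restrict_space borel (X \<times> Y)" and ?\<pi> = "\<mu> \<Otimes>\<^sub>M \<nu>"
  have sets: "sets \<gamma> = sets ?N" "sets ?\<pi> = sets ?N"
    using sets_restrict_space_pair[OF \<mu>'(2) \<nu>'(2) X(1) Y(1)] C.coupling_facts(2) by auto
  define G :: "(real ^ 'm) \<times> (real ^ 'n) \<Rightarrow> ((real ^ 'm) \<times> real) \<times> ((real ^ 'n) \<times> real) \<Rightarrow> real"
    where "G p w = halfspace_ind (fst p) (fst w) * halfspace_ind (snd p) (snd w)" for p w
  define L where "L = 1 / hs_kappa TYPE('m) RX + 1 / hs_kappa TYPE('n) RY"
  define b where "b w = (\<integral>p. G p w \<partial>\<gamma>) - (\<integral>p. G p w \<partial>?\<pi>)" for w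
  have indX: "(\<lambda>(x, \<xi>). halfspace_ind x \<xi>) \<in> borel_measurable (borel \<Otimes>\<^sub>M (hs_measure RX :: ((real ^ 'm) \<times> real) measure))"
    using measurable_hs_measure[OF measurable_halfspace_ind, of "\<lambda>x. x" borel RX] by simp
  have indY: "(\<lambda>(x, \<xi>). halfspace_ind x \<xi>) \<in> borel_measurable (borel \<Otimes>\<^sub>M (hs_measure RY :: ((real ^ 'n) \<times> real) measure))"
    using measurable_hs_measure[OF measurable_halfspace_ind, of "\<lambda>x. x" borel RY] by simp
  have Gm: "case_prod G \<in> borel_measurable (borel \<Otimes>\<^sub>M hs_prod_measure RX RY)"
    unfolding G_def split_beta' hs_prod_measure_def borel_prod[symmetric]
    by (intro borel_measurable_times measurable_Pair_compose_split[OF indX] measurable_Pair_compose_split[OF indY]) measurable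
  have Gb: "\<bar>G p w\<bar> \<le> 1" for p w by (simp add: G_def indicator_def)
  have lip: "(\<integral>w. (G p w - G q w)\<^sup>2 \<partial>hs_prod_measure RX RY) \<le> L * dist p q" for p q
  proof -
    let ?f = "\<lambda>\<xi>. (halfspace_ind (fst p) \<xi> - halfspace_ind (fst q) \<xi>)\<^sup>2 :: real"
    let ?g = "\<lambda>\<zeta>. (halfspace_ind (snd p) \<zeta> - halfspace_ind (snd q) \<zeta>)\<^sup>2 :: real"
    have f [measurable]: "?f \<in> borel_measurable (hs_measure RX)"
      using measurable_compose[OF measurable_Pair1' indX] by simp
    have g [measurable]: "?g \<in> borel_measurable (hs_measure RY)"
      using measurable_compose[OF measurable_Pair1' indY] by simp
    let ?W = "(hs_measure RX :: ((real ^ 'm) \<times> real) measure) \<Otimes>\<^sub>M (hs_measure RY :: ((real ^ 'n) \<times> real) measure)"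
    have int1: "integrable ?W (\<lambda>w. ?f (fst w))"
    proof (rule C.WZ.P.integrable_bounded)
      show "(\<lambda>w. ?f (fst w)) \<in> borel_measurable ?W"
        by (rule measurable_compose[OF measurable_fst f])
      show "\<bar>?f (fst w)\<bar> \<le> 1" for w :: "((real ^ 'm) \<times> real) \<times> ((real ^ 'n) \<times> real)"
        by (simp add: indicator_def)
    qed
    have int2: "integrable ?W (\<lambda>w. ?g (snd w))"
    proof (rule C.WZ.P.integrable_bounded)
      show "(\<lambda>w. ?g (snd w)) \<in> borel_measurable ?W"
        by (rule measurable_compose[OF measurable_snd g])
      show "\<bar>?g (snd w)\<bar> \<le> 1" for w :: "((real ^ 'm) \<times> real) \<times> ((real ^ 'n) \<times> real)"
        by (simp add: indicator_def)
    qed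
    note int = int1 int2
    note cpl = pair_measure_in_couplings[OF C.X.W.prob_space_axioms C.Y.W.prob_space_axioms]
    have "(\<integral>w. (G p w - G q w)\<^sup>2 \<partial>hs_prod_measure RX RY)
        \<le> (\<integral>w. ?f (fst w) + ?g (snd w) \<partial>(hs_measure RX \<Otimes>\<^sub>M hs_measure RY))"
      unfolding hs_prod_measure_def
    proof (rule integral_mono')
      \<comment> \<open>A product of two indicators changes only if one of the factors does.\<close>
      show "(G p w - G q w)\<^sup>2 \<le> ?f (fst w) + ?g (snd w)" for w
        by (simp add: G_def indicator_def)
    qed (use int in auto)
    also have "\<dots> = (\<integral>\<xi>. ?f \<xi> \<partial>hs_measure RX) + (\<integral>\<zeta>. ?g \<zeta> \<partial>hs_measure RY)"
      using int integral_coupling_fst[OF C.X.W.prob_space_axioms cpl f] integral_coupling_snd[OF C.X.W.prob_space_axioms cpl g]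
      by simp
    also have "\<dots> \<le> dist (fst p) (fst q) / hs_kappa TYPE('m) RX + dist (snd p) (snd q) / hs_kappa TYPE('n) RY"
      by (intro add_mono halfspace_distance_le R)
    also have "\<dots> \<le> dist p q / hs_kappa TYPE('m) RX + dist p q / hs_kappa TYPE('n) RY"
      using hs_kappa_pos[OF R(1), where 'n = 'm] hs_kappa_pos[OF R(2), where 'n = 'n]
      by (intro add_mono divide_right_mono dist_fst_le dist_snd_le) auto
    finally show ?thesis by (simp add: L_def distrib_right)
  qed
  have "has_L2_bochner_integral (hs_prod_measure RX RY) ?N (\<lambda>A. measure \<gamma> A - measure ?\<pi> A) (hs_pair X Y) b"
    unfolding b_def
  proof (rule has_L2_bochner_integral_diff[OF _ C.G.prob_space_axioms MN.prob_space_axioms sets _ Gm Gb lip])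
    show "prob_space (hs_prod_measure RX RY :: (((real ^ 'm) \<times> real) \<times> ((real ^ 'n) \<times> real)) measure)"
      unfolding hs_prod_measure_def by (rule C.WZ.prob_space_axioms)
    show "bounded (X \<times> Y)" using X Y by (intro bounded_Times)
    show "hs_pair X Y p = G p" if "p \<in> X \<times> Y" for p
      using that by (auto simp: hs_pair_def G_def half_space_def fun_eq_iff indicator_def split_beta)
  qed
  moreover have "TV_norm ?N (\<lambda>A. measure \<gamma> A - measure ?\<pi> A) \<le> 2"
    using C.G.prob_space_axioms MN.prob_space_axioms sets by (rule TV_norm_diff_le)
  moreover have "signed_measure ?N (\<lambda>A. measure \<gamma> A - measure ?\<pi> A)"
    using C.G.finite_measure_axioms MN.finite_measure_axioms sets by (rule signed_measure_diff)
  moreover have "(\<integral>p. centered_halfspace RX \<mu> (fst p) (fst w) * centered_halfspace RY \<nu> (snd p) (snd w) \<partial>\<gamma>)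
    = sqrt (hs_kappa TYPE('m) RX * hs_kappa TYPE('n) RY) * b w" for w
  proof -
    let ?f = "\<lambda>x. halfspace_ind x (fst w)" and ?g = "\<lambda>y. halfspace_ind y (snd w)"
    define m n where "m = (\<integral>x. ?f x \<partial>\<mu>)" and "n = (\<integral>y. ?g y \<partial>\<nu>)"
    have f [measurable]: "?f \<in> borel_measurable \<mu>" and g [measurable]: "?g \<in> borel_measurable \<nu>"
      by (rule measurable_halfspace_section[OF \<mu>'(4)] measurable_halfspace_section[OF \<nu>'(4)])+
    have f1: "\<bar>?f x\<bar> \<le> 1" and g1: "\<bar>?g y\<bar> \<le> 1" and fg1: "\<bar>?f x * ?g y\<bar> \<le> 1" for x y
      by (simp_all add: indicator_def)
    have f\<gamma>: "(\<lambda>p. ?f (fst p)) \<in> borel_measurable \<gamma>" and g\<gamma>: "(\<lambda>p. ?g (snd p)) \<in> borel_measurable \<gamma>"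
      using measurable_compose[OF C.coupling_facts(4) f] measurable_compose[OF C.coupling_facts(5) g] by auto
    note fg\<gamma> = borel_measurable_times[OF f\<gamma> g\<gamma>]
    note int = C.G.integrable_bounded[OF f\<gamma> f1] C.G.integrable_bounded[OF g\<gamma> g1] C.G.integrable_bounded[OF fg\<gamma> fg1]
    have "(\<lambda>p. ?f (fst p) * ?g (snd p)) \<in> borel_measurable ?\<pi>"
      using fg\<gamma> by (simp add: measurable_cong_sets[OF C.coupling_facts(2) refl])
    note int' = MN.P.integrable_bounded[OF this fg1]
    have G\<pi>: "(\<integral>p. G p w \<partial>?\<pi>) = m * n"
      using MN.integral_fst'[OF int'] unfolding G_def m_def n_def
      by (simp del: Bochner_Integration.integral_indicator)
    have fg: "(\<integral>p. ?f (fst p) \<partial>\<gamma>) = m" "(\<integral>p. ?g (snd p) \<partial>\<gamma>) = n"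
      unfolding m_def n_def by (rule integral_coupling_fst[OF \<mu>'(1) \<gamma> f] integral_coupling_snd[OF \<mu>'(1) \<gamma> g])+
    have "(\<integral>p. (?f (fst p) - m) * (?g (snd p) - n) \<partial>\<gamma>)
        = (\<integral>p. ?f (fst p) * ?g (snd p) - n * ?f (fst p) - m * ?g (snd p) + m * n \<partial>\<gamma>)"
      by (simp only: algebra_simps)
    also have "\<dots> = (\<integral>p. G p w \<partial>\<gamma>) - m * n"
      using int fg by (simp add: G_def C.G.prob_space del: Bochner_Integration.integral_indicator)
    finally have cov: "(\<integral>p. (?f (fst p) - m) * (?g (snd p) - n) \<partial>\<gamma>) = (\<integral>p. G p w \<partial>\<gamma>) - m * n" .
    have UV: "centered_halfspace RX \<mu> (fst p) (fst w) * centered_halfspace RY \<nu> (snd p) (snd w)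
      = sqrt (hs_kappa TYPE('m) RX * hs_kappa TYPE('n) RY) * ((?f (fst p) - m) * (?g (snd p) - n))" for p
      by (simp only: centered_halfspace_def m_def n_def real_sqrt_mult mult_ac)
    show ?thesis unfolding UV b_def G\<pi> using cov by simp
  qed
  ultimately show ?thesis
    unfolding dual_set_def
    by (intro CollectI exI[of _ b] exI[of _ "\<lambda>A. measure \<gamma> A - measure ?\<pi> A"]) (simp add: mult.assoc)
qed

text \<open>
  The Gromov--Wasserstein objective and the integral of the dual cost share the term
  \<open>- 4 \<integral> \<parallel>U x\<parallel>\<^sup>2 \<parallel>V y\<parallel>\<^sup>2 d\<gamma>\<close>; what remains is \<open>L2_conjugate_square\<close>. The excess is a square that vanishes at
  \<open>a = 8 m\<close>, so minimising over \<open>a\<close> recovers the objective of \<open>\<gamma>\<close>.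
\<close>

lemma dual_objective_eq:
  fixes X :: "(real ^ 'm) set" and Y :: "(real ^ 'n) set"
  assumes R: "RX > 0" "RY > 0" and X: "X \<subseteq> cball 0 RX" and Y: "Y \<subseteq> cball 0 RY"
    and \<mu>: "\<mu> \<in> borel_probs X" and \<nu>: "\<nu> \<in> borel_probs Y" and \<gamma>: "\<gamma> \<in> couplings \<mu> \<nu>"
    and a: "a \<in> L2_fun (hs_prod_measure RX RY)"
  defines "m \<equiv> \<lambda>w. \<integral>p. centered_halfspace RX \<mu> (fst p) (fst w) * centered_halfspace RY \<nu> (snd p) (snd w) \<partial>\<gamma>"
  shows "GW_const \<mu> \<nu> + (1 / 8 * (L2_norm (hs_prod_measure RX RY) a)\<^sup>2 + (\<integral>p. dual_cost X Y RX RY a \<mu> \<nu> p \<partial>\<gamma>))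
    = (\<integral>(x, y). (\<integral>(x', y'). \<bar>dist x x' - dist y y'\<bar>\<^sup>2 \<partial>\<gamma>) \<partial>\<gamma>)
      + 1 / 8 * (\<integral>w. (a w - 8 * m w)\<^sup>2 \<partial>hs_prod_measure RX RY)"
proof -
  note \<mu>' = borel_probsD[OF \<mu>] and \<nu>' = borel_probsD[OF \<nu>]
  interpret C: coupled_feature_maps \<mu> "hs_measure RX" "centered_halfspace RX \<mu>" "sqrt (hs_kappa TYPE('m) RX)"
    \<nu> "hs_measure RY" "centered_halfspace RY \<nu>" "sqrt (hs_kappa TYPE('n) RY)" \<gamma>
    by (rule coupled_feature_maps_halfspace[OF R \<mu> \<nu> \<gamma>])
  have m: "m = C.cross_moment"
    by (simp add: m_def C.cross_moment_def C.feature_def split_beta' fun_eq_iff)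
  have GW: "(\<integral>(x, y). (\<integral>(x', y'). (dist x x' - dist y y')\<^sup>2 \<partial>\<gamma>) \<partial>\<gamma>) =
      GW_const \<mu> \<nu> - 4 * (\<integral>(x, y). C.X.gram x x * C.Y.gram y y \<partial>\<gamma>)
      - 8 * (\<integral>w. (m w)\<^sup>2 \<partial>hs_prod_measure RX RY)"
    unfolding GW_const_def hs_prod_measure_def m
    by (rule C.integral_squared_difference; rule dist_eq_centered_halfspace[OF R(1)] dist_eq_centered_halfspace[OF R(2)])
       (use X Y \<mu>' \<nu>' in auto)
  have "(\<integral>p. dual_cost X Y RX RY a \<mu> \<nu> p \<partial>\<gamma>) = (\<integral>(x, y). - 4 * C.X.gram x x * C.Y.gram y y
      - 2 * (\<integral>w. a w * C.feature (x, y) w \<partial>(hs_measure RX \<Otimes>\<^sub>M hs_measure RY)) \<partial>\<gamma>)"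
  proof (rule Bochner_Integration.integral_cong[OF refl])
    fix p assume "p \<in> space \<gamma>"
    then obtain x y where p: "p = (x, y)" "x \<in> X" "y \<in> Y" by (auto simp: C.coupling_facts \<mu>' \<nu>')
    note UV = hs_embed_eq_centered_halfspace[OF \<mu> p(2)] hs_embed_eq_centered_halfspace[OF \<nu> p(3)]
    have LX: "(L2_norm (hs_measure RX) (centered_halfspace RX \<mu> x))\<^sup>2 = C.X.gram x x"
      and LY: "(L2_norm (hs_measure RY) (centered_halfspace RY \<nu> y))\<^sup>2 = C.Y.gram y y"
      unfolding L2_norm_square C.X.gram_def C.Y.gram_def by (simp_all add: power2_eq_square)
    show "dual_cost X Y RX RY a \<mu> \<nu> p = (case p of (x, y) \<Rightarrow> - 4 * C.X.gram x x * C.Y.gram y y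
      - 2 * (\<integral>w. a w * C.feature (x, y) w \<partial>(hs_measure RX \<Otimes>\<^sub>M hs_measure RY)))"
      by (simp add: p(1) dual_cost_def UV LX LY C.feature_def hs_prod_measure_def split_beta' mult.assoc)
  qed
  also have "\<dots> = - 4 * (\<integral>(x, y). C.X.gram x x * C.Y.gram y y \<partial>\<gamma>) - 2 * (\<integral>w. a w * m w \<partial>hs_prod_measure RX RY)"
    unfolding m hs_prod_measure_def by (rule C.integral_dual_cost) (use a in \<open>simp add: hs_prod_measure_def\<close>)
  finally have cost: "(\<integral>p. dual_cost X Y RX RY a \<mu> \<nu> p \<partial>\<gamma>)
      = - 4 * (\<integral>(x, y). C.X.gram x x * C.Y.gram y y \<partial>\<gamma>) - 2 * (\<integral>w. a w * m w \<partial>hs_prod_measure RX RY)" .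
  have "1 / 8 * (L2_norm (hs_prod_measure RX RY) a)\<^sup>2 - 2 * (\<integral>w. a w * m w \<partial>hs_prod_measure RX RY)
    = 1 / 8 * (\<integral>w. (a w - 8 * m w)\<^sup>2 \<partial>hs_prod_measure RX RY) - 8 * (\<integral>w. (m w)\<^sup>2 \<partial>hs_prod_measure RX RY)"
    unfolding m hs_prod_measure_def
    by (rule C.WZ.L2_conjugate_square) (use a C.cross_moment_L2 in \<open>simp_all add: hs_prod_measure_def\<close>)
  then show ?thesis using GW cost by simp
qed

theorem corollary4p2:
  fixes X :: "(real ^ 'm) set" and Y :: "(real ^ 'n) set"
    and RX RY :: real
    and \<mu> :: "(real ^ 'm) measure" and \<nu> :: "(real ^ 'n) measure"
  assumes "compact X" and "compact Y"
    and "RX > 0" and "RY > 0"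
    and "X \<subseteq> cball 0 RX" and "Y \<subseteq> cball 0 RY"
    and "\<mu> \<in> borel_probs X" and "\<nu> \<in> borel_probs Y"
  shows "GW_sq \<mu> \<nu> = GW_const \<mu> \<nu> +
    (INF a\<in>dual_set X Y RX RY.
       1 / 8 * (L2_norm (hs_prod_measure RX RY) a)\<^sup>2
       + transport_cost (dual_cost X Y RX RY a \<mu> \<nu>) \<mu> \<nu>)"
proof -
  note \<mu> = borel_probsD[OF assms(7)] and \<nu> = borel_probsD[OF assms(8)]
  let ?W = "hs_prod_measure RX RY :: (((real ^ 'm) \<times> real) \<times> ((real ^ 'n) \<times> real)) measure"
  let ?E = "GW_const \<mu> \<nu>" and ?\<A> = "dual_set X Y RX RY" and ?\<Gamma> = "couplings \<mu> \<nu>"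
  define D where "D \<gamma> = (\<integral>(x, y). (\<integral>(x', y'). \<bar>dist x x' - dist y y'\<bar>\<^sup>2 \<partial>\<gamma>) \<partial>\<gamma>)" for \<gamma> :: "((real ^ 'm) \<times> (real ^ 'n)) measure"
  define Q where "Q a \<gamma> = 1 / 8 * (L2_norm ?W a)\<^sup>2 + (\<integral>p. dual_cost X Y RX RY a \<mu> \<nu> p \<partial>\<gamma>)" for a \<gamma>
  define m where "m \<gamma> w = (\<integral>p. centered_halfspace RX \<mu> (fst p) (fst w) * centered_halfspace RY \<nu> (snd p) (snd w) \<partial>\<gamma>)" for \<gamma> w
  have Q_eq: "?E + Q a \<gamma> = D \<gamma> + 1 / 8 * (\<integral>w. (a w - 8 * m \<gamma> w)\<^sup>2 \<partial>?W)" if "a \<in> L2_fun ?W" "\<gamma> \<in> ?\<Gamma>" for a \<gamma>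
    unfolding Q_def D_def m_def by (rule dual_objective_eq[OF assms(3-8) that(2,1)])
  have Q_ge: "D \<gamma> \<le> ?E + Q a \<gamma>" if "a \<in> ?\<A>" "\<gamma> \<in> ?\<Gamma>" for a \<gamma>
    using Q_eq[of a \<gamma>] that dual_set_subset_L2 by fastforce
  have Q_attained: "\<exists>a\<in>?\<A>. D \<gamma> = ?E + Q a \<gamma>" if \<gamma>: "\<gamma> \<in> ?\<Gamma>" for \<gamma>
  proof
    show a: "(\<lambda>w. 8 * m \<gamma> w) \<in> ?\<A>"
      unfolding m_def using assms \<gamma>
      by (intro cross_moment_in_dual_set borel_compact compact_imp_bounded)
    show "D \<gamma> = ?E + Q (\<lambda>w. 8 * m \<gamma> w) \<gamma>"
      using Q_eq[OF subsetD[OF dual_set_subset_L2 a] \<gamma>] by simp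
  qed
  have D_nonneg: "0 \<le> D \<gamma>" for \<gamma> by (auto simp: D_def split_beta)
  have ne: "?\<Gamma> \<noteq> {}" using pair_measure_in_couplings[OF \<mu>(1) \<nu>(1)] by blast
  have Q_lower: "- ?E \<le> Q a \<gamma>" if "a \<in> ?\<A>" "\<gamma> \<in> ?\<Gamma>" for a \<gamma>
    using Q_ge[OF that] D_nonneg[of \<gamma>] by simp
  define T where "T a = 1 / 8 * (L2_norm ?W a)\<^sup>2 + transport_cost (dual_cost X Y RX RY a \<mu> \<nu>) \<mu> \<nu>" for a
  \<comment> \<open>By \<open>Q_lower\<close> all sets below are bounded from below; an infimum of an unbounded set of reals
    would be arbitrary.\<close>
  have T_le: "T a \<le> Q a \<gamma>" if "a \<in> ?\<A>" "\<gamma> \<in> ?\<Gamma>" for a \<gamma>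
  proof -
    have "bdd_below ((\<lambda>\<gamma>. \<integral>p. dual_cost X Y RX RY a \<mu> \<nu> p \<partial>\<gamma>) ` ?\<Gamma>)"
      using Q_lower[OF that(1)] by (intro bdd_belowI2[of _ "- ?E - 1 / 8 * (L2_norm ?W a)\<^sup>2"]) (simp add: Q_def algebra_simps)
    then show ?thesis
      unfolding T_def Q_def transport_cost_def using that by (intro add_left_mono cINF_lower)
  qed
  have T_ge: "c \<le> T a" if "\<And>\<gamma>. \<gamma> \<in> ?\<Gamma> \<Longrightarrow> c \<le> Q a \<gamma>" for a c
  proof -
    have "c - 1 / 8 * (L2_norm ?W a)\<^sup>2 \<le> transport_cost (dual_cost X Y RX RY a \<mu> \<nu>) \<mu> \<nu>"
      unfolding transport_cost_def using ne that by (intro cINF_greatest) (auto simp: Q_def algebra_simps)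
    then show ?thesis by (simp add: T_def)
  qed
  have neA: "?\<A> \<noteq> {}" using Q_attained ne by blast
  have bD: "bdd_below (D ` ?\<Gamma>)" using D_nonneg by (intro bdd_belowI2[of _ 0])
  have bT: "bdd_below (T ` ?\<A>)"
  proof (rule bdd_belowI2[of _ "- ?E"])
    show "- ?E \<le> T a" if "a \<in> ?\<A>" for a by (rule T_ge) (rule Q_lower[OF that])
  qed
  have "(INF \<gamma>\<in>?\<Gamma>. D \<gamma>) = ?E + (INF a\<in>?\<A>. T a)"
  proof (rule antisym)
    have "(INF \<gamma>\<in>?\<Gamma>. D \<gamma>) - ?E \<le> (INF a\<in>?\<A>. T a)"
    proof (intro cINF_greatest neA T_ge)
      fix a \<gamma> assume "a \<in> ?\<A>" "\<gamma> \<in> ?\<Gamma>"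
      then show "(INF \<gamma>\<in>?\<Gamma>. D \<gamma>) - ?E \<le> Q a \<gamma>"
        using Q_ge[of a \<gamma>] cINF_lower[OF bD, of \<gamma>] by simp
    qed
    then show "(INF \<gamma>\<in>?\<Gamma>. D \<gamma>) \<le> ?E + (INF a\<in>?\<A>. T a)" by simp
    show "?E + (INF a\<in>?\<A>. T a) \<le> (INF \<gamma>\<in>?\<Gamma>. D \<gamma>)"
    proof (rule cINF_greatest[OF ne])
      fix \<gamma> assume \<gamma>: "\<gamma> \<in> ?\<Gamma>"
      obtain a where a: "a \<in> ?\<A>" "D \<gamma> = ?E + Q a \<gamma>" using Q_attained[OF \<gamma>] by blast
      show "?E + (INF a\<in>?\<A>. T a) \<le> D \<gamma>"
        using cINF_lower[OF bT a(1)] T_le[OF a(1) \<gamma>] a(2) by simp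
    qed
  qed
  then show ?thesis by (simp add: GW_sq_def D_def T_def)
qed

end
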